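(* Let $M$ be a connected surface in $E^3$ consisting only of elliptic points (i.e. its Gauss curvature satisfies $K>0$ everywhere). Then the Gauss map of $M$ is of $II$-type $1$ if and only if $M$ is part of a sphere.
   Context: $M$ is a connected (sufficiently differentiable) surface in Euclidean 3-space $E^3$ with position vector $x=x(u^1,u^2)$ and Gauss map (unit normal) $n:M\to S^2\subset E^3$. The second fundamental form is $II=b_{ij}\,du^i\,du^j$ with $b_{ij}=\langle x_{/ij},n\rangle$, where $/i$ denotes $\partial/\partial u^i$; it is nondegenerate at elliptic points, and $(b^{ij})$ denotes the inverse of $(b_{ij})$. The second Beltrami operator with respect to $II$ is $\Delta^{II}\varphi:=-b^{ij}\nabla^{II}_i\varphi_{/j}$, where $\nabla^{II}_i$ is the covariant derivative (Levi-Civita connection of $II$) in the $u^i$ direction and repeated indices are summed; it is applied componentwise to vector-valued functions. The Gauss map of $M$ is of $II$-type $1$ if $\Delta^{II}n=\lambda n$ for some constant $\lambda\in\mathbb{R}$, $\lambda\neq 0$. *)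

theory Defs
  imports "HOL-Analysis.Analysis"
begin

definition pd :: "2 \<Rightarrow> (real^2 \<Rightarrow> 'a::real_normed_vector) \<Rightarrow> real^2 \<Rightarrow> 'a" where
  "pd i f u = vector_derivative (\<lambda>t. f (u + t *\<^sub>R axis i 1)) (at 0)"

text \<open>Class \<open>C\<^sup>k\<close>; only meaningful on open sets, as \<^const>\<open>pd\<close> is a two-sided derivative.\<close>

primrec Ck_on :: "nat \<Rightarrow> (real^2 \<Rightarrow> 'a::real_normed_vector) \<Rightarrow> (real^2) set \<Rightarrow> bool" where
  "Ck_on 0 f U \<longleftrightarrow> continuous_on U f"
| "Ck_on (Suc k) f U \<longleftrightarrow> f differentiable_on U \<and> (\<forall>i. Ck_on k (pd i f) U)"

text \<open>
  A surface in \<open>E\<^sup>3\<close> is a Hausdorff space \<open>M\<close> with a position vector \<open>x\<close> on \<open>M\<close> that is an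
  immersion of class \<open>C\<^sup>3\<close> in suitable local coordinates. No atlas has to be given: two
  homeomorphic coordinate maps in which \<open>x\<close> is a \<open>C\<^sup>3\<close> immersion automatically differ by
  a \<open>C\<^sup>3\<close> change of coordinates. Embedded surfaces are the case where \<open>M\<close> is a subset of
  \<open>E\<^sup>3\<close> and \<open>x\<close> is the identity. The class \<open>C\<^sup>3\<close> is what is needed for the coordinate
  expressions below to be defined: the Gauss map is \<open>C\<^sup>2\<close> and the second fundamental form \<open>C\<^sup>1\<close>.
\<close>

definition local_param ::
  "'m::t2_space set \<Rightarrow> ('m \<Rightarrow> real^3) \<Rightarrow> (real^2) set \<Rightarrow> (real^2 \<Rightarrow> 'm) \<Rightarrow> bool" where
  "local_param M x U \<phi> \<longleftrightarrow>
     open U \<and>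
     openin (top_of_set M) (\<phi> ` U) \<and>
     (\<exists>\<psi>. homeomorphism U (\<phi> ` U) \<phi> \<psi>) \<and>
     Ck_on 3 (x \<circ> \<phi>) U \<and>
     (\<forall>u\<in>U. cross3 (pd 1 (x \<circ> \<phi>) u) (pd 2 (x \<circ> \<phi>) u) \<noteq> 0)"

definition surface :: "'m::t2_space set \<Rightarrow> ('m \<Rightarrow> real^3) \<Rightarrow> bool" where
  "surface M x \<longleftrightarrow> (\<forall>p\<in>M. \<exists>U \<phi>. local_param M x U \<phi> \<and> p \<in> \<phi> ` U)"

definition gauss_map :: "'m::t2_space set \<Rightarrow> ('m \<Rightarrow> real^3) \<Rightarrow> ('m \<Rightarrow> real^3) \<Rightarrow> bool" where
  "gauss_map M x n \<longleftrightarrow>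
     continuous_on M n \<and> n ` M \<subseteq> sphere 0 1 \<and>
     (\<forall>U \<phi>. local_param M x U \<phi> \<longrightarrow> (\<forall>u\<in>U. \<forall>i. pd i (x \<circ> \<phi>) u \<bullet> n (\<phi> u) = 0))"

text \<open>In the following, \<open>X\<close> and \<open>N\<close> are the position vector and the Gauss map in local coordinates.\<close>

definition first_form :: "(real^2 \<Rightarrow> real^3) \<Rightarrow> real^2 \<Rightarrow> real^2^2" where
  "first_form X u = (\<chi> i j. pd i X u \<bullet> pd j X u)"

definition second_form :: "(real^2 \<Rightarrow> real^3) \<Rightarrow> (real^2 \<Rightarrow> real^3) \<Rightarrow> real^2 \<Rightarrow> real^2^2" where
  "second_form X N u = (\<chi> i j. pd j (pd i X) u \<bullet> N u)"

definition gauss_curvature :: "(real^2 \<Rightarrow> real^3) \<Rightarrow> (real^2 \<Rightarrow> real^3) \<Rightarrow> real^2 \<Rightarrow> real" where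
  "gauss_curvature X N u = det (second_form X N u) / det (first_form X u)"

definition elliptic :: "'m::t2_space set \<Rightarrow> ('m \<Rightarrow> real^3) \<Rightarrow> ('m \<Rightarrow> real^3) \<Rightarrow> bool" where
  "elliptic M x n \<longleftrightarrow>
     (\<forall>U \<phi>. local_param M x U \<phi> \<longrightarrow> (\<forall>u\<in>U. gauss_curvature (x \<circ> \<phi>) (n \<circ> \<phi>) u > 0))"

text \<open>
  Levi-Civita connection and second Beltrami operator of a nondegenerate, possibly
  indefinite or negative definite, metric \<open>G\<close>. The expression \<open>christoffel G k i j\<close> is
  \<open>\<Gamma>\<^sup>k\<^sub>i\<^sub>j\<close>, and \<open>cov_deriv G i \<omega> j\<close> is the component \<open>\<nabla>\<^sub>i \<omega>\<^sub>j\<close> for a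
  covector field \<open>\<omega>\<close>.
\<close>

definition christoffel :: "(real^2 \<Rightarrow> real^2^2) \<Rightarrow> 2 \<Rightarrow> 2 \<Rightarrow> 2 \<Rightarrow> real^2 \<Rightarrow> real" where
  "christoffel G k i j u =
     (1/2) * (\<Sum>l\<in>UNIV. matrix_inv (G u) $ k $ l *
        (pd i (\<lambda>v. G v $ l $ j) u + pd j (\<lambda>v. G v $ l $ i) u - pd l (\<lambda>v. G v $ i $ j) u))"

definition cov_deriv ::
  "(real^2 \<Rightarrow> real^2^2) \<Rightarrow> 2 \<Rightarrow> (2 \<Rightarrow> real^2 \<Rightarrow> real) \<Rightarrow> 2 \<Rightarrow> real^2 \<Rightarrow> real" where
  "cov_deriv G i \<omega> j u = pd i (\<omega> j) u - (\<Sum>k\<in>UNIV. christoffel G k i j u * \<omega> k u)"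

definition beltrami2 :: "(real^2 \<Rightarrow> real^2^2) \<Rightarrow> (real^2 \<Rightarrow> real) \<Rightarrow> real^2 \<Rightarrow> real" where
  "beltrami2 G f u =
     - (\<Sum>i\<in>UNIV. \<Sum>j\<in>UNIV. matrix_inv (G u) $ i $ j * cov_deriv G i (\<lambda>j. pd j f) j u)"

definition vec_beltrami2 :: "(real^2 \<Rightarrow> real^2^2) \<Rightarrow> (real^2 \<Rightarrow> real^3) \<Rightarrow> real^2 \<Rightarrow> real^3" where
  "vec_beltrami2 G F u = (\<chi> c. beltrami2 G (\<lambda>v. F v $ c) u)"

definition gauss_map_II_type_1 ::
  "'m::t2_space set \<Rightarrow> ('m \<Rightarrow> real^3) \<Rightarrow> ('m \<Rightarrow> real^3) \<Rightarrow> bool" where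
  "gauss_map_II_type_1 M x n \<longleftrightarrow>
     (\<exists>c::real. c \<noteq> 0 \<and>
        (\<forall>U \<phi>. local_param M x U \<phi> \<longrightarrow>
           (\<forall>u\<in>U. vec_beltrami2 (second_form (x \<circ> \<phi>) (n \<circ> \<phi>)) (n \<circ> \<phi>) u
                    = c *\<^sub>R n (\<phi> u))))"

definition part_of_sphere :: "'m::t2_space set \<Rightarrow> ('m \<Rightarrow> real^3) \<Rightarrow> bool" where
  "part_of_sphere M x \<longleftrightarrow> (\<exists>c r. r > 0 \<and> x ` M \<subseteq> sphere c r)"

end

theory Submission imports Defs begin

text \<open>
  In local coordinates let \<open>X\<close> be the position vector, \<open>N\<close> the Gauss map, and \<open>b\<close> the second
  fundamental form; indices on \<open>X\<close> and \<open>N\<close> denote partial derivatives. The components of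
  \<open>\<Delta>\<^sup>I\<^sup>I N\<close> are
  \<open>b\<^sup>i\<^sup>j N\<^sub>i \<bullet> N\<^sub>j = 2H\<close> along \<open>N\<close>, and half of the gradient of \<open>log K\<close> tangentially. So the
  Gauss map is of type 1 iff \<open>H\<close> and \<open>K\<close> are constant, with eigenvalue \<open>2H\<close>.

  Suppose that the constant principal curvatures \<open>k\<^sub>1\<close> and \<open>k\<^sub>2\<close> differ. The maps
  \<open>y = k\<^sub>1 X + N\<close> and \<open>z = k\<^sub>2 X + N\<close> have rank one and \<open>y\<^sub>i \<bullet> z\<^sub>j = 0\<close>. The tensor
  \<open>y\<^sub>i\<^sub>k \<bullet> z\<^sub>j = - y\<^sub>i \<bullet> z\<^sub>j\<^sub>k\<close> is totally symmetric and is annihilated by both eigendirections of the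
  shape operator, hence it vanishes. So the unit principal direction \<open>e\<close> along the \<open>z\<^sub>j\<close> satisfies
  \<open>e\<^sub>k = c (e \<bullet> z\<^sub>k) N\<close> with a constant \<open>c \<noteq> 0\<close>, and the symmetry of the second derivatives of
  \<open>e\<close> makes \<open>N\<^sub>1\<close> and \<open>N\<^sub>2\<close> linearly dependent, contradicting \<open>K \<noteq> 0\<close>. Therefore all points are
  umbilic, \<open>N\<^sub>i = - H X\<^sub>i\<close>, and \<open>X + N / H\<close> is locally constant.
\<close>

section \<open>Partial derivatives and the classes \<open>C\<^sup>k\<close>\<close>

text \<open>The chain rule along the line in direction \<open>axis i 1\<close> ties the line
  derivative in \<open>pd\<close> to the Frechet derivative; the sum, product and linearity rules
  below are inherited through it.\<close>

lemma pd_eq_derivative: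
  assumes "(f has_derivative f') (at u)"
  shows "pd i f u = f' (axis i 1)"
proof -
  have "((\<lambda>t. u + t *\<^sub>R axis i 1) has_derivative (\<lambda>t. t *\<^sub>R axis i 1)) (at (0::real))"
    by (auto intro!: derivative_eq_intros)
  moreover have "(f has_derivative f') (at (u + 0 *\<^sub>R axis i 1))" using assms by simp
  ultimately have "((\<lambda>t. f (u + t *\<^sub>R axis i 1)) has_derivative (\<lambda>t. f' (t *\<^sub>R axis i 1))) (at 0)"
    using diff_chain_at[of "\<lambda>t. u + t *\<^sub>R axis i 1" _ 0 f f'] by (simp add: o_def)
  moreover have "f' (t *\<^sub>R axis i 1) = t *\<^sub>R f' (axis i 1)" for t
    using assms has_derivative_bounded_linear linear_simps(5) by blast
  ultimately show ?thesis
    unfolding pd_def by (simp add: vector_derivative_at has_vector_derivative_def)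
qed

lemma pd_const [simp]: "pd i (\<lambda>u. c) u = 0"
  by (simp add: pd_def)

lemma pd_add:
  assumes "f differentiable (at u)" "g differentiable (at u)"
  shows "pd i (\<lambda>v. f v + g v) u = pd i f u + pd i g u"
proof -
  obtain f' g' where f': "(f has_derivative f') (at u)" and g': "(g has_derivative g') (at u)"
    using assms unfolding differentiable_def by blast
  show ?thesis
    unfolding pd_eq_derivative[OF f'] pd_eq_derivative[OF g']
      pd_eq_derivative[OF has_derivative_add[OF f' g']] by simp
qed

lemma pd_bounded_linear:
  assumes "bounded_linear h" "f differentiable (at u)"
  shows "pd i (\<lambda>v. h (f v)) u = h (pd i f u)"
proof -
  obtain f' where f': "(f has_derivative f') (at u)"
    using assms unfolding differentiable_def by blast
  show ?thesis
    unfolding pd_eq_derivative[OF f'] pd_eq_derivative[OF bounded_linear.has_derivative[OF assms(1) f']] by simp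
qed

lemma pd_bilinear:
  assumes "bounded_bilinear B" "f differentiable (at u)" "g differentiable (at u)"
  shows "pd i (\<lambda>v. B (f v) (g v)) u = B (f u) (pd i g u) + B (pd i f u) (g u)"
proof -
  obtain f' g' where f': "(f has_derivative f') (at u)" and g': "(g has_derivative g') (at u)"
    using assms unfolding differentiable_def by blast
  show ?thesis
    unfolding pd_eq_derivative[OF f'] pd_eq_derivative[OF g']
      pd_eq_derivative[OF bounded_bilinear.FDERIV[OF assms(1) f' g']] by simp
qed

lemmas pd_inner = pd_bilinear[OF bounded_bilinear_inner]
lemmas pd_scaleR = pd_bilinear[OF bounded_bilinear_scaleR]
lemmas pd_mult = pd_bilinear[OF bounded_bilinear_mult]

text \<open>For small \<open>t\<close> the line through \<open>u\<close> stays in the open set, so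
  identities known only on \<open>U\<close> may be differentiated there.\<close>

lemma pd_cong:
  assumes "open U" "u \<in> U" "\<And>v. v \<in> U \<Longrightarrow> f v = g v"
  shows "pd i f u = pd i g u"
proof -
  have "\<forall>\<^sub>F t in nhds (0::real). u + t *\<^sub>R axis i 1 \<in> U"
  proof -
    have "((\<lambda>t. u + t *\<^sub>R axis i 1) \<longlongrightarrow> u + 0 *\<^sub>R axis i 1) (nhds (0::real))"
      by (intro tendsto_intros filterlim_ident)
    then show ?thesis
      using topological_tendstoD[OF _ assms(1)] assms(2) by fastforce
  qed
  then have "\<forall>\<^sub>F t in nhds (0::real). f (u + t *\<^sub>R axis i 1) = g (u + t *\<^sub>R axis i 1)"
    by eventually_elim (use assms in auto)
  then show ?thesis
    unfolding pd_def by (intro vector_derivative_cong_eq) auto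
qed

lemma Ck_on_cong:
  assumes "open U" "\<And>v. v \<in> U \<Longrightarrow> f v = g v"
  shows "Ck_on k f U \<longleftrightarrow> Ck_on k g U"
  using assms(2)
proof (induction k arbitrary: f g)
  case 0
  then show ?case by (simp cong: continuous_on_cong)
next
  case (Suc k)
  have "f differentiable_on U \<longleftrightarrow> g differentiable_on U"
    using Suc.prems by (metis differentiable_on_def differentiable_transform_within zero_less_one)
  moreover have "Ck_on k (pd i f) U = Ck_on k (pd i g) U" for i
    using Suc.prems by (intro Suc.IH pd_cong[OF assms(1)])
  ultimately show ?case by simp
qed

lemma Ck_on_subset: "Ck_on k f U \<Longrightarrow> V \<subseteq> U \<Longrightarrow> Ck_on k f V"
  by (induction k arbitrary: f) (auto intro: continuous_on_subset differentiable_on_subset)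

lemma Ck_on_Suc_imp: "Ck_on (Suc k) f U \<Longrightarrow> Ck_on k f U"
  by (induction k arbitrary: f) (auto intro: differentiable_imp_continuous_on)

lemma Ck_on_le: "Ck_on k f U \<Longrightarrow> j \<le> k \<Longrightarrow> Ck_on j f U"
  by (induction k) (auto simp: le_Suc_eq simp del: Ck_on.simps intro: Ck_on_Suc_imp)

lemma Ck_on_pd: "Ck_on (Suc k) f U \<Longrightarrow> Ck_on k (pd i f) U"
  by simp

lemma Ck_on_differentiable:
  "Ck_on (Suc k) f U \<Longrightarrow> open U \<Longrightarrow> u \<in> U \<Longrightarrow> f differentiable (at u)"
  by (simp add: differentiable_on_eq_differentiable_at)

text \<open>In \<open>Ck_on\<close>, \<open>pd i f\<close> is a function on the whole plane, while a
  formula \<open>g i\<close> for it usually holds on \<open>U\<close> only;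
  \<open>Ck_on_cong\<close> bridges this.\<close>

lemma Ck_on_SucI:
  assumes "open U" "\<And>u. u \<in> U \<Longrightarrow> f differentiable (at u)"
    "\<And>i. Ck_on k (g i) U" "\<And>i u. u \<in> U \<Longrightarrow> pd i f u = g i u"
  shows "Ck_on (Suc k) f U"
  using assms Ck_on_cong[OF assms(1), of "pd i f" "g i" k for i]
  by (auto simp: differentiable_on_eq_differentiable_at)

lemma Ck_on_add:
  assumes "open U"
  shows "Ck_on k f U \<Longrightarrow> Ck_on k g U \<Longrightarrow> Ck_on k (\<lambda>u. f u + g u) U"
proof (induction k arbitrary: f g)
  case (Suc k)
  note d = Ck_on_differentiable[OF Suc.prems(1) assms] Ck_on_differentiable[OF Suc.prems(2) assms]
  show ?case
    using Suc d
    by (intro Ck_on_SucI[OF assms, where g = "\<lambda>i u. pd i f u + pd i g u"] differentiable_add pd_add) auto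
qed (auto intro: continuous_on_add)

lemma Ck_on_bounded_linear:
  assumes "open U" "bounded_linear h"
  shows "Ck_on k f U \<Longrightarrow> Ck_on k (\<lambda>u. h (f u)) U"
proof (induction k arbitrary: f)
  case 0
  then show ?case using assms(2) by (auto intro: bounded_linear.continuous_on)
next
  case (Suc k)
  note d = Ck_on_differentiable[OF Suc.prems assms(1)]
  have "(\<lambda>u. h (f u)) differentiable (at u)" if "u \<in> U" for u
    using d[OF that] bounded_linear.has_derivative[OF assms(2)] unfolding differentiable_def by blast
  then show ?case
    using Suc d assms(2)
    by (intro Ck_on_SucI[OF assms(1), where g = "\<lambda>i u. h (pd i f u)"] pd_bounded_linear) auto
qed

lemma Ck_on_bilinear:
  assumes "open U" and B: "bounded_bilinear B"
  shows "Ck_on k f U \<Longrightarrow> Ck_on k g U \<Longrightarrow> Ck_on k (\<lambda>u. B (f u) (g u)) U"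
proof (induction k arbitrary: f g)
  case 0
  then show ?case using bounded_bilinear.continuous_on[OF B] by auto
next
  case (Suc k)
  note d = Ck_on_differentiable[OF Suc.prems(1) assms(1)] Ck_on_differentiable[OF Suc.prems(2) assms(1)]
  have "(\<lambda>u. B (f u) (g u)) differentiable (at u)" if "u \<in> U" for u
    using d[OF that] bounded_bilinear.FDERIV[OF B]
    unfolding differentiable_def by blast
  moreover have "Ck_on k (\<lambda>u. B (f u) (pd i g u) + B (pd i f u) (g u)) U" for i
    using Suc.prems[THEN Ck_on_Suc_imp] Suc.prems by (intro Ck_on_add[OF assms(1)] Suc.IH) auto
  ultimately show ?case
    using Suc.prems d
    by (intro Ck_on_SucI[OF assms(1), where g = "\<lambda>i u. B (f u) (pd i g u) + B (pd i f u) (g u)"] pd_bilinear[OF B])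
      auto
qed

lemmas Ck_on_inner = Ck_on_bilinear[OF _ bounded_bilinear_inner]
lemmas Ck_on_scaleR = Ck_on_bilinear[OF _ bounded_bilinear_scaleR]
lemmas Ck_on_mult = Ck_on_bilinear[OF _ bounded_bilinear_mult]
lemmas Ck_on_cmult = Ck_on_bounded_linear[OF _ bounded_linear_mult_right]
lemmas Ck_on_cscaleR = Ck_on_bounded_linear[OF _ bounded_linear_scaleR_right]

lemma bounded_bilinear_cross3: "bounded_bilinear cross3"
  using bilinear_cross bilinear_conv_bounded_bilinear by blast

lemmas Ck_on_cross3 = Ck_on_bilinear[OF _ bounded_bilinear_cross3]

text \<open>The exponent is generalised in the induction because differentiation lowers it by one.
  With exponent \<open>-1/2\<close> on squared lengths this serves to normalise vector
  fields.\<close>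

lemma Ck_on_powr:
  fixes h :: "real^2 \<Rightarrow> real"
  assumes "open U" "\<And>u. u \<in> U \<Longrightarrow> h u > 0" "Ck_on k h U"
  shows "Ck_on k (\<lambda>u. h u powr a) U"
  using assms(3)
proof (induction k arbitrary: a)
  case 0
  have "continuous_on U h" using 0 by simp
  moreover have "\<forall>u\<in>U. h u \<noteq> 0" using assms(2) by (metis less_irrefl)
  ultimately show ?case
    using continuous_on_powr[OF _ continuous_on_const] by simp
next
  case (Suc k)
  note d = Ck_on_differentiable[OF Suc.prems assms(1)]
  have *: "((\<lambda>u. h u powr a) has_derivative (\<lambda>v. (a * h u powr (a - 1)) * h' v)) (at u)"
    if "u \<in> U" "(h has_derivative h') (at u)" for u h'
    using diff_chain_at[OF that(2)
        has_real_derivative_powr[OF assms(2)[OF that(1)], of a, unfolded has_field_derivative_def]]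
    by (simp add: o_def)
  have "(\<lambda>u. h u powr a) differentiable (at u)" if "u \<in> U" for u
    using d[OF that] *[OF that] unfolding differentiable_def by blast
  moreover have "pd i (\<lambda>u. h u powr a) u = (a * h u powr (a - 1)) * pd i h u" if "u \<in> U" for i u
    using d[OF that] *[OF that] unfolding differentiable_def by (metis pd_eq_derivative)
  moreover have "Ck_on k (\<lambda>u. (a * h u powr (a - 1)) * pd i h u) U" for i
    using Suc.IH[OF Ck_on_Suc_imp[OF Suc.prems]] Ck_on_pd[OF Suc.prems] assms(1)
    by (intro Ck_on_mult Ck_on_cmult)
  ultimately show ?case by (intro Ck_on_SucI[OF assms(1)])
qed

section \<open>Symmetry of second partial derivatives\<close>

lemma pd_line_derivative:
  fixes f :: "real^2 \<Rightarrow> real"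
  assumes "f differentiable (at (w + s *\<^sub>R axis i 1))"
  shows "((\<lambda>t. f (w + t *\<^sub>R axis i 1)) has_real_derivative pd i f (w + s *\<^sub>R axis i 1)) (at s)"
proof -
  let ?u = "w + s *\<^sub>R axis i 1"
  obtain f' where f': "(f has_derivative f') (at ?u)"
    using assms unfolding differentiable_def by blast
  have "((\<lambda>t. w + t *\<^sub>R axis i 1) has_derivative (\<lambda>t. t *\<^sub>R axis i 1)) (at s)"
    by (auto intro!: derivative_eq_intros)
  from diff_chain_at[OF this f']
  have "((\<lambda>t. f (w + t *\<^sub>R axis i 1)) has_derivative (\<lambda>t. f' (t *\<^sub>R axis i 1))) (at s)"
    by (simp add: o_def)
  moreover have "f' (t *\<^sub>R axis i 1) = f' (axis i 1) * t" for t
    using f' has_derivative_bounded_linear linear_simps(5) by (metis mult.commute real_scaleR_def)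
  ultimately show ?thesis
    by (simp add: has_field_derivative_def pd_eq_derivative[OF f'])
qed

text \<open>The mean value theorem is applied twice: in direction \<open>i\<close> to the difference
  over a step in direction \<open>j\<close>, then in direction \<open>j\<close> to
  \<open>pd i f\<close>. The bound \<open>2 * h < d\<close> keeps the whole parallelogram in the
  ball.\<close>

lemma second_difference_mvt:
  fixes f :: "real^2 \<Rightarrow> real"
  assumes "open U" "Ck_on 2 f U" "ball u d \<subseteq> U" "h > 0" "2 * h < d"
  shows "\<exists>v\<in>ball u d. f (u + h *\<^sub>R axis i 1 + h *\<^sub>R axis j 1) - f (u + h *\<^sub>R axis i 1)
           - f (u + h *\<^sub>R axis j 1) + f u = h * h * pd j (pd i f) v"
proof -
  have C1: "Ck_on (Suc 0) (pd i f) U" and C2: "Ck_on (Suc (Suc 0)) f U"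
    using assms(2) by (simp_all add: numeral_2_eq_2)
  have inU: "u + s *\<^sub>R axis i 1 + t *\<^sub>R axis j 1 \<in> ball u d"
    if "0 \<le> s" "s \<le> h" "0 \<le> t" "t \<le> h" for s t
  proof -
    have "dist u (u + s *\<^sub>R axis i 1 + t *\<^sub>R axis j 1) = norm (s *\<^sub>R axis i 1 + t *\<^sub>R axis j (1::real))"
      by (metis add.assoc add_diff_cancel_left' dist_commute dist_norm)
    moreover have "norm (s *\<^sub>R axis i 1 + t *\<^sub>R axis j (1::real)) \<le> s + t"
      using norm_triangle_ineq[of "s *\<^sub>R axis i 1" "t *\<^sub>R axis j (1::real)"] that by simp
    ultimately show ?thesis using that assms(5) by simp
  qed
  have inU0: "u + s *\<^sub>R axis i 1 \<in> U" if "0 \<le> s" "s \<le> h" for s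
    using inU[of s 0] that assms by auto
  define \<phi> where "\<phi> s = f (u + s *\<^sub>R axis i 1 + h *\<^sub>R axis j 1) - f (u + s *\<^sub>R axis i 1)" for s
  have "(\<phi> has_real_derivative (pd i f (u + s *\<^sub>R axis i 1 + h *\<^sub>R axis j 1) - pd i f (u + s *\<^sub>R axis i 1))) (at s)"
    if "0 \<le> s" "s \<le> h" for s
  proof -
    have "((\<lambda>t. f ((u + h *\<^sub>R axis j 1) + t *\<^sub>R axis i 1)) has_real_derivative
        pd i f ((u + h *\<^sub>R axis j 1) + s *\<^sub>R axis i 1)) (at s)"
      using inU[OF that, of h] assms
      by (intro pd_line_derivative Ck_on_differentiable[OF C2]) (auto simp: algebra_simps)
    moreover have "((\<lambda>t. f (u + t *\<^sub>R axis i 1)) has_real_derivative pd i f (u + s *\<^sub>R axis i 1)) (at s)"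
      using inU0[OF that] assms by (intro pd_line_derivative Ck_on_differentiable[OF C2])
    ultimately show ?thesis
      unfolding \<phi>_def by (auto intro!: derivative_eq_intros simp: algebra_simps)
  qed
  from MVT2[OF assms(4) this]
  obtain s where s: "0 < s" "s < h" and
    1: "\<phi> h - \<phi> 0 = h * (pd i f (u + s *\<^sub>R axis i 1 + h *\<^sub>R axis j 1) - pd i f (u + s *\<^sub>R axis i 1))"
    by auto
  have "((\<lambda>t. pd i f (u + s *\<^sub>R axis i 1 + t *\<^sub>R axis j 1)) has_real_derivative
      pd j (pd i f) (u + s *\<^sub>R axis i 1 + t *\<^sub>R axis j 1)) (at t)" if "0 \<le> t" "t \<le> h" for t
    using inU[of s t] s that assms by (intro pd_line_derivative Ck_on_differentiable[OF C1]) auto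
  from MVT2[OF assms(4) this]
  obtain t where "0 < t" "t < h" and
    2: "pd i f (u + s *\<^sub>R axis i 1 + h *\<^sub>R axis j 1) - pd i f (u + s *\<^sub>R axis i 1)
       = h * pd j (pd i f) (u + s *\<^sub>R axis i 1 + t *\<^sub>R axis j 1)" by auto
  with 1 s inU[of s t] show ?thesis
    by (intro bexI[of _ "u + s *\<^sub>R axis i 1 + t *\<^sub>R axis j 1"]) (auto simp: \<phi>_def algebra_simps)
qed

text \<open>The second difference is symmetric in \<open>i\<close> and \<open>j\<close>, so a small
  ball around \<open>u\<close> contains points \<open>v\<close> and \<open>w\<close> at which the
  two iterated derivatives have the same value; continuity transfers this to
  \<open>u\<close>.\<close>

lemma pd_commute_real:
  fixes f :: "real^2 \<Rightarrow> real"
  assumes "open U" "Ck_on 2 f U" "u \<in> U"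
  shows "pd i (pd j f) u = pd j (pd i f) u"
proof (rule ccontr)
  assume "\<not> ?thesis"
  \<comment> \<open>Half of the gap: two errors below \<open>e\<close> cannot close it.\<close>
  define e where "e = \<bar>pd i (pd j f) u - pd j (pd i f) u\<bar> / 2"
  with \<open>\<not> ?thesis\<close> have e: "e > 0" by simp
  have c: "continuous_on U (pd k (pd l f))" for k l
    using assms(2) by (simp add: numeral_2_eq_2)
  obtain d0 where d0: "d0 > 0" "ball u d0 \<subseteq> U" using assms open_contains_ball by blast
  have ex: "\<exists>d>0. \<forall>v\<in>U. dist v u < d \<longrightarrow> \<bar>pd k (pd l f) v - pd k (pd l f) u\<bar> < e" for k l
    using c[of k l] assms(3) e unfolding continuous_on_iff dist_real_def by blast
  obtain d1 where d1: "d1 > 0" "\<And>v. v \<in> U \<Longrightarrow> dist v u < d1 \<Longrightarrow> \<bar>pd i (pd j f) v - pd i (pd j f) u\<bar> < e"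
    using ex[of i j] by blast
  obtain d2 where d2: "d2 > 0" "\<And>v. v \<in> U \<Longrightarrow> dist v u < d2 \<Longrightarrow> \<bar>pd j (pd i f) v - pd j (pd i f) u\<bar> < e"
    using ex[of j i] by blast
  define d where "d = min d0 (min d1 d2)"
  have d: "d > 0" "ball u d \<subseteq> U" using d0 d1 d2 by (auto simp: d_def)
  define h where "h = d / 3"
  have h: "h > 0" "2 * h < d" using d by (auto simp: h_def)
  obtain w where w: "w \<in> ball u d"
    and 1: "f (u + h *\<^sub>R axis i 1 + h *\<^sub>R axis j 1) - f (u + h *\<^sub>R axis i 1)
      - f (u + h *\<^sub>R axis j 1) + f u = h * h * pd j (pd i f) w"
    using second_difference_mvt[OF assms(1,2) d(2) h, of i j] by blast
  obtain v where v: "v \<in> ball u d"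
    and "f (u + h *\<^sub>R axis j 1 + h *\<^sub>R axis i 1) - f (u + h *\<^sub>R axis j 1)
      - f (u + h *\<^sub>R axis i 1) + f u = h * h * pd i (pd j f) v"
    using second_difference_mvt[OF assms(1,2) d(2) h, of j i] by blast
  then have "h * h * pd i (pd j f) v = h * h * pd j (pd i f) w"
    using 1 unfolding add.assoc add.commute[of "h *\<^sub>R axis i 1" "h *\<^sub>R axis j 1"] by linarith
  then have "pd i (pd j f) v = pd j (pd i f) w" using h by auto
  moreover have "\<bar>pd i (pd j f) v - pd i (pd j f) u\<bar> < e"
    using v d by (intro d1) (auto simp: d_def dist_commute)
  moreover have "\<bar>pd j (pd i f) w - pd j (pd i f) u\<bar> < e"
    using w d by (intro d2) (auto simp: d_def dist_commute)
  ultimately show False unfolding e_def by argo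
qed

lemma pd_commute:
  fixes f :: "real^2 \<Rightarrow> 'a::euclidean_space"
  assumes "open U" "Ck_on 2 f U" "u \<in> U"
  shows "pd i (pd j f) u = pd j (pd i f) u"
proof (rule euclidean_eqI)
  fix b :: 'a
  have C1: "Ck_on (Suc 0) (pd i f) U" and C2: "Ck_on (Suc (Suc 0)) f U" for i
    using assms(2) by (simp_all add: numeral_2_eq_2)
  have "pd k (pd l (\<lambda>v. f v \<bullet> b)) u = pd k (pd l f) u \<bullet> b" for k l
  proof -
    have "pd k (pd l (\<lambda>v. f v \<bullet> b)) u = pd k (\<lambda>v. pd l f v \<bullet> b) u"
      using assms by (intro pd_cong[OF assms(1,3)] pd_bounded_linear bounded_linear_inner_left
          Ck_on_differentiable[OF C2])
    also have "\<dots> = pd k (pd l f) u \<bullet> b"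
      using assms by (intro pd_bounded_linear bounded_linear_inner_left Ck_on_differentiable[OF C1])
    finally show ?thesis .
  qed
  with pd_commute_real[OF assms(1) Ck_on_bounded_linear[OF assms(1) bounded_linear_inner_left assms(2)] assms(3)]
  show "pd i (pd j f) u \<bullet> b = pd j (pd i f) u \<bullet> b" by metis
qed

section \<open>Local differential geometry\<close>

lemma matrix_inv_works:
  fixes A :: "real^'n^'n"
  assumes "det A \<noteq> 0"
  shows "A ** matrix_inv A = mat 1" "matrix_inv A ** A = mat 1"
proof -
  have "\<exists>B. A ** B = mat 1 \<and> B ** A = mat 1"
    using assms invertible_det_nz[of A] unfolding invertible_def by blast
  from someI_ex[OF this] show "A ** matrix_inv A = mat 1" "matrix_inv A ** A = mat 1"
    unfolding matrix_inv_def by blast+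
qed

text \<open>The triple product expansion makes \<open>cross3 m (cross3 p q)\<close> vanish; crossing
  this with \<open>cross3 p q\<close> and expanding again gives the identity.\<close>

lemma normal_parallel_cross3:
  fixes p q m :: "real^3"
  assumes "m \<bullet> p = 0" "m \<bullet> q = 0"
  shows "(cross3 p q \<bullet> cross3 p q) *\<^sub>R m = (cross3 p q \<bullet> m) *\<^sub>R cross3 p q"
proof -
  have "cross3 m (cross3 p q) = 0" using assms by (simp add: Lagrange)
  then have "cross3 (cross3 p q) (cross3 m (cross3 p q)) = 0" by simp
  then show ?thesis unfolding Lagrange[of "cross3 p q"] by simp
qed

text \<open>Both \<open>m\<close> and \<open>v\<close> are multiples of \<open>cross3 p q\<close>,
  and they are orthogonal to each other. This reduces vector identities to inner products with a
  frame.\<close>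

lemma orthogonal_to_frame_eq_0:
  fixes p q m v :: "real^3"
  assumes "cross3 p q \<noteq> 0" "m \<noteq> 0" "m \<bullet> p = 0" "m \<bullet> q = 0"
    and "v \<bullet> p = 0" "v \<bullet> q = 0" "v \<bullet> m = 0"
  shows "v = 0"
proof -
  let ?w = "cross3 p q"
  have m: "(?w \<bullet> ?w) *\<^sub>R m = (?w \<bullet> m) *\<^sub>R ?w" and v: "(?w \<bullet> ?w) *\<^sub>R v = (?w \<bullet> v) *\<^sub>R ?w"
    using assms by (auto intro: normal_parallel_cross3)
  have "?w \<bullet> m \<noteq> 0" using m assms(1,2) by auto
  moreover have "(?w \<bullet> m) * (?w \<bullet> v) = 0"
    using arg_cong[OF m, of "\<lambda>x. x \<bullet> v"] assms(7) by (simp add: inner_commute)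
  ultimately have "?w \<bullet> v = 0" by simp
  with v assms(1) show ?thesis by simp
qed

text \<open>Multiplying by \<open>G\<close> cancels the inverse metric and leaves the Christoffel
  symbols of the first kind.\<close>

lemma christoffel_lower:
  assumes "det (G u) \<noteq> 0"
  shows "(\<Sum>k\<in>UNIV. G u $ l $ k * christoffel G k i j u)
    = (pd i (\<lambda>v. G v $ l $ j) u + pd j (\<lambda>v. G v $ l $ i) u - pd l (\<lambda>v. G v $ i $ j) u) / 2"
proof -
  define t :: "real^2" where
    "t = (\<chi> l. (pd i (\<lambda>v. G v $ l $ j) u + pd j (\<lambda>v. G v $ l $ i) u - pd l (\<lambda>v. G v $ i $ j) u) / 2)"
  have "christoffel G k i j u = (matrix_inv (G u) *v t) $ k" for k
    by (simp add: christoffel_def t_def matrix_vector_mult_def sum_2)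
  then have "(\<Sum>k\<in>UNIV. G u $ l $ k * christoffel G k i j u) = (G u *v (matrix_inv (G u) *v t)) $ l"
    by (simp add: matrix_vector_mult_def)
  also have "\<dots> = t $ l"
    by (simp add: matrix_vector_mul_assoc matrix_inv_works[OF assms])
  finally show ?thesis by (simp add: t_def)
qed

text \<open>Coordinate projections are linear and commute with \<open>pd\<close>, so the
  componentwise operator becomes a vector expression that can be paired with a frame.\<close>

lemma vec_beltrami2_expand:
  assumes "open U" "Ck_on 2 F U" "u \<in> U"
  shows "vec_beltrami2 G F u = - (\<Sum>i\<in>UNIV. \<Sum>j\<in>UNIV. matrix_inv (G u) $ i $ j *\<^sub>R
    (pd i (pd j F) u - (\<Sum>k\<in>UNIV. christoffel G k i j u *\<^sub>R pd k F u)))"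
proof -
  have C1: "Ck_on (Suc 0) (pd i F) U" and C2: "Ck_on (Suc (Suc 0)) F U" for i
    using assms(2) by (simp_all add: numeral_2_eq_2)
  have 1: "pd k (\<lambda>v. F v $ c) v = pd k F v $ c" if "v \<in> U" for k c v
    using that assms by (intro pd_bounded_linear bounded_linear_vec_nth Ck_on_differentiable[OF C2])
  have 2: "pd i (pd j (\<lambda>v. F v $ c)) u = pd i (pd j F) u $ c" for i j c
  proof -
    have "pd i (pd j (\<lambda>v. F v $ c)) u = pd i (\<lambda>v. pd j F v $ c) u"
      by (intro pd_cong[OF assms(1,3)] 1)
    also have "\<dots> = pd i (pd j F) u $ c"
      using assms by (intro pd_bounded_linear bounded_linear_vec_nth Ck_on_differentiable[OF C1])
    finally show ?thesis .
  qed
  show ?thesis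
    unfolding vec_eq_iff vec_beltrami2_def beltrami2_def cov_deriv_def
    by (simp add: 1[OF assms(3)] 2)
qed

lemma pd_zero_imp_constant_on:
  fixes f :: "real^2 \<Rightarrow> 'a::real_normed_vector"
  assumes "open U" "connected U"
    and "\<And>u. u \<in> U \<Longrightarrow> f differentiable (at u)" "\<And>u i. u \<in> U \<Longrightarrow> pd i f u = 0"
  shows "f constant_on U"
proof -
  have "(f has_derivative (\<lambda>_. 0)) (at u)" if u: "u \<in> U" for u
  proof -
    obtain f' where f': "(f has_derivative f') (at u)"
      using assms(3)[OF u] unfolding differentiable_def by blast
    interpret f': linear f' using f' has_derivative_linear by blast
    have "f' (axis i 1) = 0" for i
      using pd_eq_derivative[OF f', of i] assms(4)[OF u] by simp
    then have "f' v = 0" for v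
      using basis_expansion[of v] f'.sum[of "\<lambda>i. (v $ i) *s axis i 1" UNIV]
      by (simp add: f'.scale scalar_mult_eq_scaleR)
    then have "f' = (\<lambda>_. 0)" by (rule ext)
    with f' show ?thesis by simp
  qed
  then have "\<forall>u\<in>U. \<forall>v\<in>U. f u = f v"
    using has_derivative_zero_unique_connected[OF assms(1,2), of f] by blast
  then show ?thesis unfolding constant_on_def by metis
qed

text \<open>
  Here \<open>a\<close> is the shape matrix in \<open>N\<^sub>i = a\<^sub>i\<^sub>k X\<^sub>k\<close>, \<open>d\<^sub>i\<^sub>j\<close> stands for \<open>\<partial>\<^sub>l a\<^sub>i\<^sub>j\<close> and \<open>t\<^sub>k\<^sub>j\<close> for
  \<open>X\<^sub>k\<^sub>l \<bullet> X\<^sub>j\<close>. The conclusion is \<open>\<partial>\<^sub>l det a = 0\<close>, i.e. constancy of \<open>K\<close>.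
\<close>

lemma adjugate_contraction:
  fixes a11 :: real
  assumes "a11 * g12 + a12 * g22 = a21 * g11 + a22 * g12"
    and "b11 = - (a11 * g11 + a12 * g12)" "b12 = - (a11 * g12 + a12 * g22)"
      "b22 = - (a21 * g12 + a22 * g22)"
    and "b22 * ((d11 * g11 + d12 * g12 + a11 * t11 + a12 * t21) - (a11 * t11 + a12 * t12))
      - b12 * ((d11 * g12 + d12 * g22 + a11 * t12 + a12 * t22) - (a21 * t11 + a22 * t12))
      - b12 * ((d21 * g11 + d22 * g12 + a21 * t11 + a22 * t21) - (a11 * t21 + a12 * t22))
      + b11 * ((d21 * g12 + d22 * g22 + a21 * t12 + a22 * t22) - (a21 * t21 + a22 * t22)) = 0"
  shows "(g11 * g22 - g12 * g12) * (d11 * a22 + a11 * d22 - d12 * a21 - a12 * d21) = 0"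
  using assms by algebra

text \<open>The matrix \<open>a\<close> is self-adjoint for the definite form \<open>g\<close>, so
  its characteristic polynomial has real roots, which coincide only if \<open>a\<close> is
  scalar.\<close>

lemma self_adjoint_discriminant:
  fixes a11 :: real
  assumes "a11 * g12 + a12 * g22 = a21 * g11 + a22 * g12"
    and "g11 * g22 - g12 * g12 > 0"
  shows "(a11 - a22)\<^sup>2 + 4 * a12 * a21 \<ge> 0"
    and "(a11 - a22)\<^sup>2 + 4 * a12 * a21 = 0 \<Longrightarrow> a11 = a22 \<and> a12 = 0 \<and> a21 = 0"
proof -
  have pos: "g11 * g22 > 0" using assms(2) zero_le_square[of g12] by linarith
  \<comment> \<open>Self-adjointness reads \<open>(a11 - a22) * g12 = a21 * g11 - a12 * g22\<close>;
    its square turns the scaled discriminant into a sum of two nonnegative terms.\<close>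
  have eq: "g11 * g22 * ((a11 - a22)\<^sup>2 + 4 * a12 * a21)
      = (a12 * g22 + a21 * g11)\<^sup>2 + (a11 - a22)\<^sup>2 * (g11 * g22 - g12 * g12)"
    using assms(1) by algebra
  have nonneg: "0 \<le> (a12 * g22 + a21 * g11)\<^sup>2" "0 \<le> (a11 - a22)\<^sup>2 * (g11 * g22 - g12 * g12)"
    using assms(2) by auto
  then show "(a11 - a22)\<^sup>2 + 4 * a12 * a21 \<ge> 0"
    using pos eq by (metis add_nonneg_nonneg zero_le_mult_iff not_le)
  assume "(a11 - a22)\<^sup>2 + 4 * a12 * a21 = 0"
  with eq nonneg have "(a12 * g22 + a21 * g11)\<^sup>2 = 0" "(a11 - a22)\<^sup>2 * (g11 * g22 - g12 * g12) = 0"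
    by (metis add_nonneg_eq_0_iff mult_zero_right)+
  then have 1: "a12 * g22 + a21 * g11 = 0" and 2: "a11 = a22" using assms(2) by auto
  with assms(1) have "a12 * g22 = 0" "a21 * g11 = 0" by simp_all
  with pos 2 show "a11 = a22 \<and> a12 = 0 \<and> a21 = 0" by auto
qed

section \<open>Surface patches: regularity of the Gauss map and Weingarten relations\<close>

locale surface_patch =
  fixes U :: "(real^2) set" and X N :: "real^2 \<Rightarrow> real^3"
  assumes open_U: "open U" and connected_U: "connected U"
    and C3_X: "Ck_on 3 X U"
    and immersion: "u \<in> U \<Longrightarrow> cross3 (pd 1 X u) (pd 2 X u) \<noteq> 0"
    and continuous_N: "continuous_on U N"
    and norm_N: "u \<in> U \<Longrightarrow> norm (N u) = 1"
    and tangent_N: "u \<in> U \<Longrightarrow> pd i X u \<bullet> N u = 0"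
begin

lemma frame_eq_0I:
  "u \<in> U \<Longrightarrow> (\<And>i. v \<bullet> pd i X u = 0) \<Longrightarrow> v \<bullet> N u = 0 \<Longrightarrow> v = 0"
  using orthogonal_to_frame_eq_0[OF immersion, of u "N u" v] tangent_N[of u] norm_N[of u]
  by (metis inner_commute norm_zero zero_neq_one)

lemma C_X: "Ck_on (Suc (Suc (Suc 0))) X U" "Ck_on (Suc (Suc 0)) (pd i X) U"
  "Ck_on (Suc 0) (pd j (pd i X)) U" "Ck_on (Suc (Suc 0)) X U"
  using C3_X Ck_on_le[OF C3_X, of 2] by (simp_all add: numeral_2_eq_2 numeral_3_eq_3)

text \<open>The locale assumes only continuity of \<open>N\<close>. The normalised cross product
  \<open>\<nu>\<close> is of class C2 and \<open>N\<close> is \<open>\<nu>\<close> up to a sign;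
  this sign is continuous with values in a finite set, hence constant on the connected set
  \<open>U\<close>.\<close>

lemma C2_N: "Ck_on 2 N U"
proof -
  define W where "W u = cross3 (pd 1 X u) (pd 2 X u)" for u
  define \<nu> where "\<nu> u = ((W u \<bullet> W u) powr (-1/2)) *\<^sub>R W u" for u
  have W: "W u \<bullet> W u > 0" if "u \<in> U" for u
    using immersion[OF that] by (simp add: W_def)
  have CW: "Ck_on 2 W U"
    unfolding W_def using C_X(2) by (intro Ck_on_cross3 open_U) (simp_all add: numeral_2_eq_2)
  then have C\<nu>: "Ck_on 2 \<nu> U"
    unfolding \<nu>_def using W by (intro Ck_on_scaleR Ck_on_powr Ck_on_inner open_U)
  have sq: "((W u \<bullet> W u) powr (-1/2)) * ((W u \<bullet> W u) powr (-1/2)) * (W u \<bullet> W u) = 1" if "u \<in> U" for u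
    unfolding powr_add[symmetric] using W[OF that] by (simp add: powr_minus)
  have N: "N u = (\<nu> u \<bullet> N u) *\<^sub>R \<nu> u" if "u \<in> U" for u
  proof -
    have "(W u \<bullet> W u) *\<^sub>R N u = (W u \<bullet> N u) *\<^sub>R W u"
      unfolding W_def using tangent_N[OF that]
      by (intro normal_parallel_cross3) (simp_all add: inner_commute)
    then have "(((W u \<bullet> W u) powr (-1/2)) * ((W u \<bullet> W u) powr (-1/2)) * (W u \<bullet> W u)) *\<^sub>R N u
       = (\<nu> u \<bullet> N u) *\<^sub>R \<nu> u"
      unfolding \<nu>_def by (simp add: scaleR_scaleR[symmetric] del: scaleR_scaleR) (simp add: ac_simps)
    then show ?thesis using sq[OF that] by simp
  qed
  have "(\<nu> u \<bullet> N u)\<^sup>2 = 1" if "u \<in> U" for u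
    using arg_cong[OF N[OF that], of "\<lambda>v. v \<bullet> N u"] norm_N[OF that]
    by (simp add: power2_eq_square norm_eq_1)
  then have "(\<lambda>u. \<nu> u \<bullet> N u) ` U \<subseteq> {1, -1}"
    by (auto simp: power2_eq_1_iff)
  moreover have "continuous_on U (\<lambda>u. \<nu> u \<bullet> N u)"
    using Ck_on_le[OF C\<nu>, of 0] continuous_N by (intro continuous_on_inner) simp_all
  ultimately have "(\<lambda>u. \<nu> u \<bullet> N u) constant_on U"
    using continuous_finite_range_constant[OF connected_U] finite_subset by blast
  then obtain s where "\<And>u. u \<in> U \<Longrightarrow> \<nu> u \<bullet> N u = s" unfolding constant_on_def by blast
  then have "Ck_on 2 N U \<longleftrightarrow> Ck_on 2 (\<lambda>u. s *\<^sub>R \<nu> u) U"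
    using N by (intro Ck_on_cong open_U) metis
  then show ?thesis using Ck_on_cscaleR[OF open_U C\<nu>] by simp
qed

lemma C_N: "Ck_on (Suc (Suc 0)) N U" "Ck_on (Suc 0) (pd i N) U"
  using C2_N by (simp_all add: numeral_2_eq_2)

lemma differentiable:
  assumes "u \<in> U"
  shows "X differentiable (at u)" "pd i X differentiable (at u)" "pd j (pd i X) differentiable (at u)"
    "N differentiable (at u)" "pd i N differentiable (at u)"
  using Ck_on_differentiable[OF C_X(1) open_U assms] Ck_on_differentiable[OF C_X(2) open_U assms]
    Ck_on_differentiable[OF C_X(3) open_U assms] Ck_on_differentiable[OF C_N(1) open_U assms]
    Ck_on_differentiable[OF C_N(2) open_U assms] by blast+

lemma X_commute: "u \<in> U \<Longrightarrow> pd i (pd j X) u = pd j (pd i X) u"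
  using pd_commute[OF open_U] C_X(4) by (simp add: numeral_2_eq_2)

lemma N_commute: "u \<in> U \<Longrightarrow> pd i (pd j N) u = pd j (pd i N) u"
  using pd_commute[OF open_U C2_N] by simp

lemma pd_inner_const:
  assumes "u \<in> U" "f differentiable (at u)" "g differentiable (at u)" "\<And>v. v \<in> U \<Longrightarrow> f v \<bullet> g v = c"
  shows "f u \<bullet> pd i g u + pd i f u \<bullet> g u = 0"
  using pd_cong[OF open_U assms(1), of "\<lambda>v. f v \<bullet> g v" "\<lambda>v. c" i] assms
  by (simp add: pd_inner)

lemma N_inner_pd_N: "u \<in> U \<Longrightarrow> N u \<bullet> pd i N u = 0"
  using pd_inner_const[of u N N 1 i] differentiable[of u] norm_N by (simp add: inner_commute norm_eq_1)

lemma tangent_N': "u \<in> U \<Longrightarrow> N u \<bullet> pd i X u = 0"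
  using tangent_N by (simp add: inner_commute)

lemma pd_N_inner_N: "u \<in> U \<Longrightarrow> pd i N u \<bullet> N u = 0"
  using N_inner_pd_N by (simp add: inner_commute)

lemma weingarten: "u \<in> U \<Longrightarrow> pd j (pd i X) u \<bullet> N u = - (pd i X u \<bullet> pd j N u)"
  using pd_inner_const[of u "pd i X" N 0 j] differentiable[of u] tangent_N by simp

lemma shape_sym: "u \<in> U \<Longrightarrow> pd i X u \<bullet> pd j N u = pd j X u \<bullet> pd i N u"
  using weingarten X_commute by (metis neg_equal_iff_equal)

lemma second_form_eq:
  assumes "u \<in> U"
  shows "second_form X N u $ i $ j = - (pd j X u \<bullet> pd i N u)"
  using weingarten[OF assms] shape_sym[OF assms] by (simp add: second_form_def)

lemma pd_second_form:
  assumes "u \<in> U"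
  shows "pd k (\<lambda>v. second_form X N v $ i $ j) u
    = - (pd k (pd i N) u \<bullet> pd j X u) - pd i N u \<bullet> pd k (pd j X) u"
proof -
  have "pd k (\<lambda>v. second_form X N v $ i $ j) u = pd k (\<lambda>v. - (pd j X v \<bullet> pd i N v)) u"
    by (intro pd_cong[OF open_U assms] second_form_eq)
  also have "\<dots> = - pd k (\<lambda>v. pd j X v \<bullet> pd i N v) u"
    using differentiable[OF assms]
    by (intro pd_bounded_linear[OF bounded_linear_minus[OF bounded_linear_ident]] differentiable_inner)
  also have "pd k (\<lambda>v. pd j X v \<bullet> pd i N v) u = pd j X u \<bullet> pd k (pd i N) u + pd k (pd j X) u \<bullet> pd i N u"
    using differentiable[OF assms] by (intro pd_inner)
  finally show ?thesis by (simp add: inner_commute)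
qed

text \<open>By symmetry of the second form the other index may be put on \<open>N\<close>. Choosing
  between the two expansions makes terms cancel in \<open>beltrami2_N\<close>.\<close>

lemma pd_second_form':
  assumes "u \<in> U"
  shows "pd k (\<lambda>v. second_form X N v $ i $ j) u
    = - (pd k (pd j N) u \<bullet> pd i X u) - pd j N u \<bullet> pd k (pd i X) u"
  using pd_second_form[OF assms, of k j i]
    pd_cong[OF open_U assms, of "\<lambda>v. second_form X N v $ i $ j" "\<lambda>v. second_form X N v $ j $ i" k]
    second_form_eq shape_sym by simp

lemma second_form_sym: "u \<in> U \<Longrightarrow> second_form X N u $ i $ j = second_form X N u $ j $ i"
  using second_form_eq shape_sym by metis

section \<open>The Beltrami operator applied to the Gauss map\<close>

text \<open>
  The Christoffel symbols enter \<open>\<nabla>\<^sub>i N\<^sub>j\<close> through \<open>\<Gamma>\<^sup>k\<^sub>i\<^sub>j N\<^sub>k\<close>, and \<open>N\<^sub>k \<bullet> X\<^sub>l = - b\<^sub>k\<^sub>l\<close>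
  lowers their upper index. So no inverse of \<open>b\<close> is left in the inner products with the frame.
\<close>

lemma beltrami2_N:
  assumes u: "u \<in> U" and "det (second_form X N u) \<noteq> 0"
  defines "P \<equiv> matrix_inv (second_form X N u)"
  shows "vec_beltrami2 (second_form X N) N u \<bullet> pd l X u =
      - (\<Sum>i\<in>UNIV. \<Sum>j\<in>UNIV. P $ i $ j *
          (pd l (pd i N) u \<bullet> pd j X u - pd j N u \<bullet> pd l (pd i X) u)) / 2" (is ?tangential)
    and "vec_beltrami2 (second_form X N) N u \<bullet> N u =
      (\<Sum>i\<in>UNIV. \<Sum>j\<in>UNIV. P $ i $ j * (pd i N u \<bullet> pd j N u))" (is ?normal)
proof -
  let ?G = "second_form X N"
  define V where "V i j = pd i (pd j N) u - (\<Sum>k\<in>UNIV. christoffel ?G k i j u *\<^sub>R pd k N u)" for i j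
  have B: "vec_beltrami2 ?G N u = - (\<Sum>i\<in>UNIV. \<Sum>j\<in>UNIV. P $ i $ j *\<^sub>R V i j)"
    unfolding P_def V_def by (rule vec_beltrami2_expand[OF open_U C2_N u])
  have "V i j \<bullet> N u = - (pd i N u \<bullet> pd j N u)" for i j
  proof -
    have "N u \<bullet> pd i (pd j N) u + pd i N u \<bullet> pd j N u = 0"
      using differentiable[OF u] N_inner_pd_N by (intro pd_inner_const[OF u])
    then show ?thesis
      unfolding V_def using N_inner_pd_N[OF u]
      by (simp add: inner_diff_right inner_sum_right inner_commute[of _ "N u"])
  qed
  then show ?normal
    unfolding B by (simp add: inner_sum_left sum_negf)
  have "V i j \<bullet> pd l X u = (pd l (pd i N) u \<bullet> pd j X u - pd j N u \<bullet> pd l (pd i X) u) / 2" for i j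
  proof -
    have "(\<Sum>k\<in>UNIV. christoffel ?G k i j u *\<^sub>R pd k N u) \<bullet> pd l X u
        = - (\<Sum>k\<in>UNIV. ?G u $ l $ k * christoffel ?G k i j u)"
    proof -
      have "?G u $ l $ k = - (pd k N u \<bullet> pd l X u)" for k
        using second_form_sym[OF u, of l k] second_form_eq[OF u, of k l] by (simp add: inner_commute)
      then show ?thesis by (simp add: inner_sum_left sum_negf mult.commute)
    qed
    also have "\<dots> = pd i (pd j N) u \<bullet> pd l X u
        + (pd j N u \<bullet> pd l (pd i X) u - pd l (pd i N) u \<bullet> pd j X u) / 2"
      \<comment> \<open>The three derivatives of the second form are expanded so that the terms
        \<open>pd i N u \<bullet> pd l (pd j X) u\<close> cancel and
        \<open>pd i (pd j N) u \<bullet> pd l X u\<close> appears twice.\<close>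
      unfolding christoffel_lower[of ?G u, OF assms(2)]
      unfolding pd_second_form[OF u, of l i j] pd_second_form'[OF u, of i l j] pd_second_form'[OF u, of j l i]
      using X_commute[OF u, of i l] X_commute[OF u, of j l] N_commute[OF u, of i j]
      by (simp add: field_simps)
    finally show ?thesis unfolding V_def by (simp add: inner_diff_left field_simps)
  qed
  note V_X = this
  show ?tangential
    unfolding B inner_minus_left inner_sum_left inner_scaleR_left V_X by (simp add: sum_divide_distrib)
qed


abbreviation "b i j u \<equiv> second_form X N u $ i $ j"
abbreviation "g i j u \<equiv> pd i X u \<bullet> pd j X u"

lemma inverse_second_form:
  fixes u
  assumes "det (second_form X N u) \<noteq> 0"
  defines "P \<equiv> matrix_inv (second_form X N u)"
  shows "P $ i $ 1 * b 1 j u + P $ i $ 2 * b 2 j u = (if i = j then 1 else 0)"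
  using arg_cong[OF matrix_inv_works(2)[OF assms(1)], of "\<lambda>A. A $ i $ j"]
  by (simp add: P_def matrix_matrix_mult_def sum_2 mat_def)

text \<open>Tangentially, the two terms in \<open>beltrami2_N\<close> cancel because the second
  derivatives of \<open>N\<close> are \<open>s\<close> times those of \<open>X\<close>. Along
  \<open>N\<close> the contraction is \<open>- s\<close> times the trace of the identity matrix,
  which is 2.\<close>

lemma beltrami2_N_homothetic:
  assumes u: "u \<in> U" and "det (second_form X N u) \<noteq> 0"
    and s: "\<And>v i. v \<in> U \<Longrightarrow> pd i N v = s *\<^sub>R pd i X v"
  shows "vec_beltrami2 (second_form X N) N u = (- 2 * s) *\<^sub>R N u"
proof -
  let ?V = "vec_beltrami2 (second_form X N) N u + (2 * s) *\<^sub>R N u"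
  define P where "P = matrix_inv (second_form X N u)"
  note bel = beltrami2_N[OF assms(1,2), folded P_def]
  have "pd l (pd i N) u = s *\<^sub>R pd l (pd i X) u" for l i
  proof -
    have "pd l (pd i N) u = pd l (\<lambda>v. s *\<^sub>R pd i X v) u" by (intro pd_cong[OF open_U u] s)
    then show ?thesis by (simp add: pd_bounded_linear[OF bounded_linear_scaleR_right differentiable(2)[OF u]])
  qed
  then have "?V \<bullet> pd l X u = 0" for l
    using bel(1)[of l] tangent_N'[OF u] s[OF u]
    by (simp add: inner_add_left inner_commute[of "pd l (pd _ X) u"])
  moreover have "?V \<bullet> N u = 0"
  proof -
    have N: "pd i N u \<bullet> pd j N u = - s * b j i u" for i j
      using second_form_eq[OF u, of j i] s[OF u] by simp
    have "(\<Sum>i\<in>UNIV. \<Sum>j\<in>UNIV. P $ i $ j * (pd i N u \<bullet> pd j N u))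
      = - s * ((P $ 1 $ 1 * b 1 1 u + P $ 1 $ 2 * b 2 1 u) + (P $ 2 $ 1 * b 1 2 u + P $ 2 $ 2 * b 2 2 u))"
      unfolding N by (simp add: sum_2 algebra_simps)
    also have "\<dots> = - 2 * s"
      using inverse_second_form[OF assms(2)] by (simp add: P_def)
    finally show ?thesis
      using bel(2) norm_N[OF u] by (simp add: inner_add_left norm_eq_1)
  qed
  ultimately have "?V = 0" using frame_eq_0I[OF u] by blast
  then show ?thesis by (simp add: add_eq_0_iff2)
qed

section \<open>The shape matrix and the type 1 condition\<close>

lemma det_g_pos: "u \<in> U \<Longrightarrow> g 1 1 u * g 2 2 u - g 1 2 u * g 1 2 u > 0"
  using immersion[of u] dot_cross[of "pd 1 X u" "pd 2 X u" "pd 1 X u" "pd 2 X u"]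
  by (metis inner_commute inner_gt_zero_iff)

lemma X_independent:
  assumes "u \<in> U" "\<alpha> *\<^sub>R pd 1 X u + \<beta> *\<^sub>R pd 2 X u = 0"
  shows "\<alpha> = 0" "\<beta> = 0"
proof -
  have "\<alpha> *\<^sub>R cross3 (pd 1 X u) (pd 2 X u) = cross3 (\<alpha> *\<^sub>R pd 1 X u + \<beta> *\<^sub>R pd 2 X u) (pd 2 X u)"
    "\<beta> *\<^sub>R cross3 (pd 1 X u) (pd 2 X u) = cross3 (pd 1 X u) (\<alpha> *\<^sub>R pd 1 X u + \<beta> *\<^sub>R pd 2 X u)"
    by (simp_all add: cross_add_left cross_add_right cross_mult_left cross_mult_right)
  then show "\<alpha> = 0" "\<beta> = 0" unfolding assms(2) using immersion[OF assms(1)] by simp_all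
qed

text \<open>Cramer's rule for the coefficients of \<open>pd i N\<close> in the basis
  \<open>pd 1 X\<close>, \<open>pd 2 X\<close>; the explicit quotient makes differentiability
  evident. With this sign the eigenvalues are the negatives of the principal curvatures.\<close>

definition shape :: "2 \<Rightarrow> 2 \<Rightarrow> real^2 \<Rightarrow> real" where
  "shape i k u =
    (if k = 1 then (pd i N u \<bullet> pd 1 X u) * g 2 2 u - (pd i N u \<bullet> pd 2 X u) * g 1 2 u
     else (pd i N u \<bullet> pd 2 X u) * g 1 1 u - (pd i N u \<bullet> pd 1 X u) * g 1 2 u)
    / (g 1 1 u * g 2 2 u - g 1 2 u * g 1 2 u)"

lemma pd_N_eq:
  assumes u: "u \<in> U"
  shows "pd i N u = shape i 1 u *\<^sub>R pd 1 X u + shape i 2 u *\<^sub>R pd 2 X u"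
proof -
  let ?V = "pd i N u - (shape i 1 u *\<^sub>R pd 1 X u + shape i 2 u *\<^sub>R pd 2 X u)"
  let ?D = "g 1 1 u * g 2 2 u - g 1 2 u * g 1 2 u"
  have D: "?D \<noteq> 0" using det_g_pos[OF u] by simp
  have s: "shape i 1 u * ?D = (pd i N u \<bullet> pd 1 X u) * g 2 2 u - (pd i N u \<bullet> pd 2 X u) * g 1 2 u"
    "shape i 2 u * ?D = (pd i N u \<bullet> pd 2 X u) * g 1 1 u - (pd i N u \<bullet> pd 1 X u) * g 1 2 u"
    using D by (simp_all add: shape_def)
  have "?D * (?V \<bullet> pd 1 X u) = 0" "?D * (?V \<bullet> pd 2 X u) = 0"
    using s inner_commute[of "pd 2 X u" "pd 1 X u"]
    unfolding inner_diff_left inner_add_left inner_scaleR_left by algebra+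
  then have "\<forall>l. ?V \<bullet> pd l X u = 0" using D by (auto simp: forall_2)
  moreover have "?V \<bullet> N u = 0"
    using tangent_N[OF u] pd_N_inner_N[OF u] by (simp add: inner_diff_left inner_add_left)
  ultimately have "?V = 0" using frame_eq_0I[OF u] by blast
  then show ?thesis by simp
qed

lemma shape_unique:
  assumes "u \<in> U" "pd i N u = \<alpha> *\<^sub>R pd 1 X u + \<beta> *\<^sub>R pd 2 X u"
  shows "shape i 1 u = \<alpha>" "shape i 2 u = \<beta>"
proof -
  have "(shape i 1 u - \<alpha>) *\<^sub>R pd 1 X u + (shape i 2 u - \<beta>) *\<^sub>R pd 2 X u = 0"
    using pd_N_eq[OF assms(1), of i] assms(2) by (simp add: algebra_simps)
  from X_independent[OF assms(1) this] show "shape i 1 u = \<alpha>" "shape i 2 u = \<beta>" by simp_all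
qed

lemma shape_differentiable:
  assumes "u \<in> U"
  shows "shape i k differentiable (at u)"
proof -
  have "(\<lambda>u. if k = 1 then A u else B u) differentiable (at u)"
    if "A differentiable (at u)" "B differentiable (at u)" for A B :: "real^2 \<Rightarrow> real"
    using that by (cases "k = 1") auto
  then show ?thesis
    unfolding shape_def[abs_def] using differentiable[OF assms] det_g_pos[OF assms]
    by (intro differentiable_divide differentiable_diff differentiable_mult differentiable_inner) auto
qed

lemma second_form_shape:
  assumes "u \<in> U"
  shows "b i j u = - (shape i 1 u * g 1 j u + shape i 2 u * g 2 j u)"
  using second_form_eq[OF assms] pd_N_eq[OF assms, of i]
  by (simp add: inner_commute[of "pd j X u"] inner_add_left)

lemma shape_self_adjoint:
  assumes "u \<in> U"
  shows "shape 1 1 u * g 1 2 u + shape 1 2 u * g 2 2 u = shape 2 1 u * g 1 1 u + shape 2 2 u * g 1 2 u"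
  using second_form_sym[OF assms, of 1 2] unfolding second_form_shape[OF assms]
  by (simp add: inner_commute)

lemma pd_pd_N:
  assumes u: "u \<in> U"
  shows "pd l (pd i N) u = pd l (shape i 1) u *\<^sub>R pd 1 X u + pd l (shape i 2) u *\<^sub>R pd 2 X u
     + shape i 1 u *\<^sub>R pd l (pd 1 X) u + shape i 2 u *\<^sub>R pd l (pd 2 X) u"
proof -
  note d = shape_differentiable[OF u] differentiable[OF u]
  have "pd l (pd i N) u = pd l (\<lambda>v. shape i 1 v *\<^sub>R pd 1 X v + shape i 2 v *\<^sub>R pd 2 X v) u"
    by (intro pd_cong[OF open_U u] pd_N_eq)
  also have "\<dots> = pd l (\<lambda>v. shape i 1 v *\<^sub>R pd 1 X v) u + pd l (\<lambda>v. shape i 2 v *\<^sub>R pd 2 X v) u"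
    using d by (intro pd_add differentiable_scaleR)
  finally show ?thesis using d by (simp add: pd_scaleR)
qed

text \<open>The component along \<open>N\<close> of the eigenvalue equation gives the trace. The
  tangential components, multiplied by the determinant of the second form, give a contraction with
  its adjugate, to which \<open>adjugate_contraction\<close> applies.\<close>

lemma type_1_shape:
  assumes u: "u \<in> U" and det: "det (second_form X N u) \<noteq> 0"
    and T: "vec_beltrami2 (second_form X N) N u = c *\<^sub>R N u"
  shows "shape 1 1 u + shape 2 2 u = - c"
    and "pd l (\<lambda>v. shape 1 1 v * shape 2 2 v - shape 1 2 v * shape 2 1 v) u = 0"
proof -
  define P where "P = matrix_inv (second_form X N u)"
  note bel = beltrami2_N[OF u det, folded P_def]
  note P = inverse_second_form[OF det, folded P_def]
  have N: "pd i N u \<bullet> pd j N u = - (shape i 1 u * b j 1 u + shape i 2 u * b j 2 u)" for i j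
    using second_form_eq[OF u, of j] by (subst pd_N_eq[OF u, of i]) (simp add: inner_add_left)
  have "c = (\<Sum>i\<in>UNIV. \<Sum>j\<in>UNIV. P $ i $ j * (pd i N u \<bullet> pd j N u))"
    using bel(2) T norm_N[OF u] by (simp add: norm_eq_1)
  also have "\<dots> = - (shape 1 1 u * (P $ 1 $ 1 * b 1 1 u + P $ 1 $ 2 * b 2 1 u)
      + shape 1 2 u * (P $ 1 $ 1 * b 1 2 u + P $ 1 $ 2 * b 2 2 u)
      + shape 2 1 u * (P $ 2 $ 1 * b 1 1 u + P $ 2 $ 2 * b 2 1 u)
      + shape 2 2 u * (P $ 2 $ 1 * b 1 2 u + P $ 2 $ 2 * b 2 2 u))"
    unfolding N sum_2 by (simp add: algebra_simps)
  finally show "shape 1 1 u + shape 2 2 u = - c" unfolding P by simp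
  let ?\<Delta> = "det (second_form X N u)"
  have \<Delta>: "?\<Delta> = b 1 1 u * b 2 2 u - b 1 2 u * b 1 2 u"
    using second_form_sym[OF u, of 2 1] by (simp add: det_2)
  have adj: "?\<Delta> * P $ 1 $ 1 = b 2 2 u" "?\<Delta> * P $ 1 $ 2 = - b 1 2 u"
    "?\<Delta> * P $ 2 $ 1 = - b 1 2 u" "?\<Delta> * P $ 2 $ 2 = b 1 1 u"
    using P[of 1 1] P[of 1 2] P[of 2 1] P[of 2 2] second_form_sym[OF u, of 2 1]
    unfolding \<Delta> by simp_all algebra+
  define C where "C i j = pd l (pd i N) u \<bullet> pd j X u - pd j N u \<bullet> pd l (pd i X) u" for i j
  have "(\<Sum>i\<in>UNIV. \<Sum>j\<in>UNIV. P $ i $ j * C i j) = 0"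
    using bel(1)[of l] T tangent_N[OF u] unfolding C_def by (simp add: inner_commute)
  then have "?\<Delta> * (P $ 1 $ 1 * C 1 1 + P $ 1 $ 2 * C 1 2 + (P $ 2 $ 1 * C 2 1 + P $ 2 $ 2 * C 2 2)) = 0"
    by (simp add: sum_2)
  then have 0: "b 2 2 u * C 1 1 - b 1 2 u * C 1 2 - b 1 2 u * C 2 1 + b 1 1 u * C 2 2 = 0"
    using adj by algebra
  have C: "C i j = (pd l (shape i 1) u * g 1 j u + pd l (shape i 2) u * g 2 j u
      + shape i 1 u * (pd l (pd 1 X) u \<bullet> pd j X u) + shape i 2 u * (pd l (pd 2 X) u \<bullet> pd j X u))
      - (shape j 1 u * (pd l (pd i X) u \<bullet> pd 1 X u) + shape j 2 u * (pd l (pd i X) u \<bullet> pd 2 X u))" for i j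
    unfolding C_def pd_pd_N[OF u] pd_N_eq[OF u, of j] inner_add_left inner_scaleR_left
    by (simp add: inner_commute)
  have sym: "g 2 1 u = g 1 2 u" by (rule inner_commute)
  have "(g 1 1 u * g 2 2 u - g 1 2 u * g 1 2 u) * (pd l (shape 1 1) u * shape 2 2 u + shape 1 1 u * pd l (shape 2 2) u
    - pd l (shape 1 2) u * shape 2 1 u - shape 1 2 u * pd l (shape 2 1) u) = 0"
    using 0 unfolding C sym
    by (intro adjugate_contraction[OF shape_self_adjoint[OF u]
          second_form_shape[OF u, of 1 1, unfolded sym] second_form_shape[OF u, of 1 2]
          second_form_shape[OF u, of 2 2]])
  then have "pd l (shape 1 1) u * shape 2 2 u + shape 1 1 u * pd l (shape 2 2) u
    - pd l (shape 1 2) u * shape 2 1 u - shape 1 2 u * pd l (shape 2 1) u = 0"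
    using det_g_pos[OF u] by simp
  moreover have "pd l (\<lambda>v. shape 1 1 v * shape 2 2 v - shape 1 2 v * shape 2 1 v) u
    = pd l (\<lambda>v. shape 1 1 v * shape 2 2 v) u + pd l (\<lambda>v. - (shape 1 2 v * shape 2 1 v)) u"
    unfolding diff_conv_add_uminus using shape_differentiable[OF u]
    by (intro pd_add differentiable_minus differentiable_mult)
  moreover have "pd l (\<lambda>v. - (shape 1 2 v * shape 2 1 v)) u = - pd l (\<lambda>v. shape 1 2 v * shape 2 1 v) u"
    using shape_differentiable[OF u]
    by (intro pd_bounded_linear[OF bounded_linear_minus[OF bounded_linear_ident]] differentiable_mult)
  ultimately show "pd l (\<lambda>v. shape 1 1 v * shape 2 2 v - shape 1 2 v * shape 2 1 v) u = 0"
    using shape_differentiable[OF u] by (simp add: pd_mult)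
qed

subsection \<open>Constant mean and Gauss curvature\<close>


lemma not_distinct_constant_principal_curvatures:
  assumes u0: "u0 \<in> U" and "k1 \<noteq> k2" "k1 * k2 \<noteq> 0"
    and tr: "\<And>u. u \<in> U \<Longrightarrow> shape 1 1 u + shape 2 2 u = - (k1 + k2)"
    and det: "\<And>u. u \<in> U \<Longrightarrow> shape 1 1 u * shape 2 2 u - shape 1 2 u * shape 2 1 u = k1 * k2"
  shows False
proof -
  define Y where "Y i u = k1 *\<^sub>R pd i X u + pd i N u" for i u
  define Z where "Z i u = k2 *\<^sub>R pd i X u + pd i N u" for i u
  \<comment> \<open>Cayley-Hamilton: with \<open>a\<close> the shape matrix,
    \<open>(a + k) (a + k') = 0\<close> when \<open>k\<close> and \<open>k'\<close> are the two
    principal curvatures. It is stated for \<open>k\<close> and \<open>k'\<close> to be used in both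
    orders.\<close>
  have kernel: "k *\<^sub>R (k' *\<^sub>R pd i X u + pd i N u) + shape i 1 u *\<^sub>R (k' *\<^sub>R pd 1 X u + pd 1 N u)
      + shape i 2 u *\<^sub>R (k' *\<^sub>R pd 2 X u + pd 2 N u) = 0"
    if u: "u \<in> U" and k: "k + k' = k1 + k2" "k * k' = k1 * k2" for i u k k'
  proof -
    have T: "shape 1 1 u + shape 2 2 u = - (k + k')" and
      D: "shape 1 1 u * shape 2 2 u - shape 1 2 u * shape 2 1 u = k * k'"
      using tr[OF u] det[OF u] k by auto
    have "k *\<^sub>R (k' *\<^sub>R pd i X u + pd i N u) + shape i 1 u *\<^sub>R (k' *\<^sub>R pd 1 X u + pd 1 N u)
        + shape i 2 u *\<^sub>R (k' *\<^sub>R pd 2 X u + pd 2 N u)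
      = (k * k') *\<^sub>R pd i X u
        + ((k + k') * shape i 1 u + shape i 1 u * shape 1 1 u + shape i 2 u * shape 2 1 u) *\<^sub>R pd 1 X u
        + ((k + k') * shape i 2 u + shape i 1 u * shape 1 2 u + shape i 2 u * shape 2 2 u) *\<^sub>R pd 2 X u"
      unfolding pd_N_eq[OF u, of i] pd_N_eq[OF u, of 1] pd_N_eq[OF u, of 2]
      by (simp add: algebra_simps)
    moreover have "(k + k') * shape 1 1 u + shape 1 1 u * shape 1 1 u + shape 1 2 u * shape 2 1 u = - (k * k')"
      "(k + k') * shape 1 2 u + shape 1 1 u * shape 1 2 u + shape 1 2 u * shape 2 2 u = 0"
      "(k + k') * shape 2 1 u + shape 2 1 u * shape 1 1 u + shape 2 2 u * shape 2 1 u = 0"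
      "(k + k') * shape 2 2 u + shape 2 1 u * shape 1 2 u + shape 2 2 u * shape 2 2 u = - (k * k')"
      using T D by algebra+
    ultimately show ?thesis using exhaust_2[of i] by auto
  qed
  have kerZ: "k1 *\<^sub>R Z i u + shape i 1 u *\<^sub>R Z 1 u + shape i 2 u *\<^sub>R Z 2 u = 0"
    and kerY: "k2 *\<^sub>R Y i u + shape i 1 u *\<^sub>R Y 1 u + shape i 2 u *\<^sub>R Y 2 u = 0" if "u \<in> U" for i u
    using kernel[OF that, of k1 k2 i] kernel[OF that, of k2 k1 i] by (simp_all add: Y_def Z_def)
  have YN: "Y i u \<bullet> N u = 0" and ZN: "Z i u \<bullet> N u = 0" if "u \<in> U" for i u
    using tangent_N[OF that] pd_N_inner_N[OF that] by (simp_all add: Y_def Z_def inner_add_left)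
  have XZ: "pd i X u \<bullet> Z j u = pd j X u \<bullet> Z i u" if "u \<in> U" for i j u
    using shape_sym[OF that, of i j] by (simp add: Z_def inner_add_right inner_commute)
  have YZ: "Y i u \<bullet> Z j u = 0" if u: "u \<in> U" for i j u
  proof -
    \<comment> \<open>\<open>Y\<close> arises from the derivatives of \<open>X\<close> by the matrix
      \<open>a + k1\<close>; the symmetry \<open>XZ\<close> moves this matrix onto \<open>Z\<close>,
      which it annihilates.\<close>
    have "Y i u \<bullet> Z j u = pd j X u \<bullet> (k1 *\<^sub>R Z i u + shape i 1 u *\<^sub>R Z 1 u + shape i 2 u *\<^sub>R Z 2 u)"
      unfolding Y_def pd_N_eq[OF u] inner_add_left inner_add_right inner_scaleR_left inner_scaleR_right
      using XZ[OF u, of _ j] by simp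
    then show ?thesis using kerZ[OF u] by simp
  qed
  have "Ck_on (Suc 0) (\<lambda>u. k *\<^sub>R pd i X u + pd i N u) U" for k i
    using Ck_on_Suc_imp[OF C_X(2)] C_N(2) by (intro Ck_on_add Ck_on_cscaleR open_U)
  then have CY: "Ck_on (Suc 0) (Y i) U" and CZ: "Ck_on (Suc 0) (Z i) U" for i
    unfolding Y_def[abs_def] Z_def[abs_def] by blast+
  have pdY: "pd j (Y i) u = k1 *\<^sub>R pd j (pd i X) u + pd j (pd i N) u"
    and pdZ: "pd j (Z i) u = k2 *\<^sub>R pd j (pd i X) u + pd j (pd i N) u" if u: "u \<in> U" for i j u
    unfolding Y_def[abs_def] Z_def[abs_def] using differentiable[OF u]
    by (simp_all add: pd_add pd_bounded_linear[OF bounded_linear_scaleR_right])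
  have commY: "pd i (Y j) u = pd j (Y i) u" and commZ: "pd i (Z j) u = pd j (Z i) u"
    if "u \<in> U" for i j u
    using pdY[OF that] pdZ[OF that] X_commute[OF that] N_commute[OF that] by metis+
  have dYZ: "Y i u \<bullet> pd k (Z j) u + pd k (Y i) u \<bullet> Z j u = 0" if u: "u \<in> U" for i j k u
    by (intro pd_inner_const[OF u, where c = 0] Ck_on_differentiable[OF CY open_U u]
        Ck_on_differentiable[OF CZ open_U u] YZ)
  have flat: "pd k (Y i) u \<bullet> Z j u = 0" if u: "u \<in> U" for i j k u
  proof -
    define A where "A i k j = pd k (Y i) u \<bullet> Z j u" for i k j
    have A': "A i k j = - (Y i u \<bullet> pd k (Z j) u)" for i k j
      using dYZ[OF u, of i k j] by (simp add: A_def)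
    have s1: "A i k j = A k i j" for i k j
      unfolding A_def by (simp only: commY[OF u, of k i])
    have s2: "A i k j = A i j k" for i k j
      unfolding A' by (simp only: commZ[OF u, of k j])
    \<comment> \<open>No kernel relation is differentiated: \<open>kerZ\<close> acts on the factor
      \<open>Z\<close> of \<open>A\<close>, and \<open>kerY\<close> on the factor \<open>Y\<close>
      of its second form \<open>A'\<close>. Total symmetry brings both contractions to the same
      slot, and their difference leaves \<open>k1 - k2\<close> times \<open>A\<close>.\<close>
    have "k1 * A i k j + shape j 1 u * A i k 1 + shape j 2 u * A i k 2 = 0"
      using arg_cong[OF kerZ[OF u, of j], of "\<lambda>v. pd k (Y i) u \<bullet> v"]
      by (simp add: A_def inner_add_right)
    moreover have "k2 * A j k i + shape j 1 u * A 1 k i + shape j 2 u * A 2 k i = 0"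
      using arg_cong[OF kerY[OF u, of j], of "\<lambda>v. v \<bullet> pd k (Z i) u"]
      unfolding A' by (simp add: inner_add_left)
    moreover have "A j k i = A i k j" "A 1 k i = A i k 1" "A 2 k i = A i k 2"
      by (metis s1 s2)+
    ultimately have "(k1 - k2) * A i k j = 0" by algebra
    then show ?thesis using assms(2) by (simp add: A_def)
  qed
  \<comment> \<open>If all these vectors vanished, \<open>u0\<close> would be umbilic with trace
    \<open>- 2 * k\<close>, against the trace hypothesis.\<close>
  have "\<exists>i. k *\<^sub>R pd i X u0 + pd i N u0 \<noteq> 0" if "- 2 * k \<noteq> - (k1 + k2)" for k
  proof (rule ccontr)
    assume "\<not> ?thesis"
    then have "pd i N u0 = (- k) *\<^sub>R pd i X u0" for i
      unfolding scaleR_minus_left by (metis add_eq_0_iff)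
    then have "shape 1 1 u0 = - k" "shape 2 2 u0 = - k"
      using shape_unique(1)[OF u0, of 1 "- k" 0] shape_unique(2)[OF u0, of 2 0 "- k"] by simp_all
    with tr[OF u0] that show False by simp
  qed
  from this[of k1] this[of k2] assms(2)
  obtain p q where p: "Y p u0 \<noteq> 0" and q: "Z q u0 \<noteq> 0" unfolding Y_def Z_def by auto
  define V where "V = {u \<in> U. Y p u \<noteq> 0 \<and> Z q u \<noteq> 0}"
  have u0V: "u0 \<in> V" and VU: "V \<subseteq> U" using p q u0 by (auto simp: V_def)
  have open_V: "open V"
  proof -
    have "continuous_on U (\<lambda>u. norm (Y p u) * norm (Z q u))"
      using Ck_on_Suc_imp[OF CY, of p] Ck_on_Suc_imp[OF CZ, of q]
      by (intro continuous_on_mult continuous_on_norm) simp_all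
    then have "open (U \<inter> (\<lambda>u. norm (Y p u) * norm (Z q u)) -` (- {0}))"
      by (intro continuous_open_preimage open_U) auto
    moreover have "V = U \<inter> (\<lambda>u. norm (Y p u) * norm (Z q u)) -` (- {0})"
      by (auto simp: V_def)
    ultimately show ?thesis by simp
  qed
  \<comment> \<open>The unit field \<open>E\<close> is orthogonal to every \<open>Y i\<close>, so
    \<open>dN\<close> gives \<open>E \<bullet> pd k N = - c * (E \<bullet> Z k)\<close> with this
    \<open>c\<close>.\<close>
  define c where "c = k1 / (k2 - k1)"
  define E where "E u = ((Z q u \<bullet> Z q u) powr (-1/2)) *\<^sub>R Z q u" for u
  have E1: "E u \<bullet> E u = 1" if "u \<in> V" for u
  proof -
    have z: "Z q u \<bullet> Z q u > 0" using that by (simp add: V_def)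
    have "E u \<bullet> E u = (Z q u \<bullet> Z q u) powr (-1/2 + -1/2) * (Z q u \<bullet> Z q u)"
      unfolding E_def powr_add by simp
    then show ?thesis using z by (simp add: powr_minus)
  qed
  have EY: "E u \<bullet> Y i u = 0" if "u \<in> V" for i u
    using YZ[of u i q] that VU by (auto simp: E_def inner_commute)
  note CZV = Ck_on_subset[OF CZ VU]
  have CE: "Ck_on (Suc 0) E V"
    unfolding E_def by (intro Ck_on_scaleR Ck_on_powr Ck_on_inner open_V CZV) (simp add: V_def)
  have C_g: "Ck_on (Suc 0) (\<lambda>u. (c * (E u \<bullet> Z k u)) *\<^sub>R N u) V" for k
    using Ck_on_subset[OF Ck_on_Suc_imp[OF C_N(1)] VU]
    by (intro Ck_on_scaleR Ck_on_cmult Ck_on_inner open_V CE CZV)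
  have dN: "(k2 - k1) *\<^sub>R pd k N u = k2 *\<^sub>R Y k u - k1 *\<^sub>R Z k u" for k u
    by (simp add: Y_def Z_def algebra_simps)
  \<comment> \<open>Tested on the frame \<open>Z q\<close>, \<open>Y p\<close>, \<open>N\<close>:
    the first component vanishes since \<open>E\<close> has unit length, the second by
    \<open>flat\<close>, and the third comes from differentiating
    \<open>E \<bullet> N = 0\<close>.\<close>
  have pdE: "pd k E u = (c * (E u \<bullet> Z k u)) *\<^sub>R N u" if u: "u \<in> V" for k u
  proof -
    have uU: "u \<in> U" using u VU by blast
    have dE: "E differentiable (at u)" by (rule Ck_on_differentiable[OF CE open_V u])
    have const: "pd k E u \<bullet> F u = - (E u \<bullet> pd k F u)"
      if "F differentiable (at u)" "\<And>v. v \<in> V \<Longrightarrow> E v \<bullet> F v = r" for F r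
      using pd_cong[OF open_V u, of "\<lambda>v. E v \<bullet> F v" "\<lambda>v. r" k] that dE by (simp add: pd_inner)
    have "pd k E u \<bullet> E u = 0"
      using const[OF dE E1] by (simp add: inner_commute)
    then have 1: "pd k E u \<bullet> Z q u = 0" using u by (simp add: E_def V_def)
    have 2: "pd k E u \<bullet> Y p u = 0"
    proof -
      have "pd k E u \<bullet> Y p u = - (E u \<bullet> pd k (Y p) u)"
        by (rule const[OF Ck_on_differentiable[OF CY open_U uU] EY])
      then show ?thesis
        using flat[OF uU, of k p q] by (simp add: E_def inner_commute)
    qed
    have 3: "pd k E u \<bullet> N u = c * (E u \<bullet> Z k u)"
    proof -
      have "E v \<bullet> N v = 0" if "v \<in> V" for v
        using ZN[of v q] that VU by (auto simp: E_def)
      then have "pd k E u \<bullet> N u = - (E u \<bullet> pd k N u)"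
        using const differentiable(4)[OF uU] by blast
      moreover have "(k2 - k1) * (E u \<bullet> pd k N u) = - k1 * (E u \<bullet> Z k u)"
        using arg_cong[OF dN, of "\<lambda>v. E u \<bullet> v" k u] EY[OF u, of k]
        by (simp add: inner_diff_right)
      ultimately show ?thesis using assms(2) by (simp add: c_def field_simps)
    qed
    have "pd k E u - (c * (E u \<bullet> Z k u)) *\<^sub>R N u = 0"
    proof (rule orthogonal_to_frame_eq_0[of "Z q u" "Y p u" "N u"])
      show "cross3 (Z q u) (Y p u) \<noteq> 0"
        using norm_and_cross_eq_0[of "Z q u" "Y p u"] YZ[OF uU, of p q] u
        by (auto simp: V_def inner_commute)
      show "N u \<noteq> 0" using norm_N[OF uU] by auto
      show NZ: "N u \<bullet> Z q u = 0" and NY: "N u \<bullet> Y p u = 0"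
        using ZN[OF uU] YN[OF uU] by (simp_all add: inner_commute)
      have "N u \<bullet> N u = 1" using norm_N[OF uU] by (simp add: norm_eq_1)
      then show "(pd k E u - (c * (E u \<bullet> Z k u)) *\<^sub>R N u) \<bullet> Z q u = 0"
        "(pd k E u - (c * (E u \<bullet> Z k u)) *\<^sub>R N u) \<bullet> Y p u = 0"
        "(pd k E u - (c * (E u \<bullet> Z k u)) *\<^sub>R N u) \<bullet> N u = 0"
        unfolding inner_diff_left inner_scaleR_left 1 2 3 NZ NY by simp_all
    qed
    then show ?thesis by simp
  qed
  \<comment> \<open>So far \<open>E\<close> is only C1, like \<open>Z\<close>; but
    \<open>pdE\<close> expresses its derivatives by C1 functions, so \<open>E\<close> gains one
    order and its second derivatives commute.\<close>
  have "Ck_on (Suc (Suc 0)) E V"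
    by (rule Ck_on_SucI[OF open_V Ck_on_differentiable[OF CE open_V] C_g pdE])
  then have "pd 1 (pd 2 E) u0 = pd 2 (pd 1 E) u0"
    using pd_commute[OF open_V _ u0V] by (simp add: numeral_2_eq_2)
  \<comment> \<open>Pairing with tangent vectors removes the term in which the scalar factor of
    \<open>N\<close> is differentiated.\<close>
  moreover have "pd l (pd k E) u0 \<bullet> pd m X u0 = c * (E u0 \<bullet> Z k u0) * (pd l N u0 \<bullet> pd m X u0)" for l k m
  proof -
    have "pd l (pd k E) u0 = pd l (\<lambda>u. (c * (E u \<bullet> Z k u)) *\<^sub>R N u) u0"
      by (intro pd_cong[OF open_V u0V] pdE)
    also have "\<dots> = (c * (E u0 \<bullet> Z k u0)) *\<^sub>R pd l N u0 + pd l (\<lambda>u. c * (E u \<bullet> Z k u)) u0 *\<^sub>R N u0"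
      by (intro pd_scaleR differentiable(4)[OF u0] Ck_on_differentiable[OF _ open_V u0V, of 0]
          Ck_on_cmult Ck_on_inner open_V CE CZV)
    finally show ?thesis using tangent_N'[OF u0] by (simp add: inner_add_left)
  qed
  ultimately have orth: "c * (E u0 \<bullet> Z 2 u0) * (pd 1 N u0 \<bullet> pd m X u0)
      = c * (E u0 \<bullet> Z 1 u0) * (pd 2 N u0 \<bullet> pd m X u0)" for m
    by metis
  define \<alpha> where "\<alpha> = E u0 \<bullet> Z 1 u0"
  define \<beta> where "\<beta> = E u0 \<bullet> Z 2 u0"
  have "c \<noteq> 0" using assms by (auto simp: c_def)
  then have "(\<beta> *\<^sub>R pd 1 N u0 - \<alpha> *\<^sub>R pd 2 N u0) \<bullet> pd m X u0 = 0" for m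
    using orth[of m] by (simp add: inner_diff_left \<alpha>_def \<beta>_def)
  then have "\<beta> *\<^sub>R pd 1 N u0 - \<alpha> *\<^sub>R pd 2 N u0 = 0"
    using pd_N_inner_N[OF u0] by (intro frame_eq_0I[OF u0]) (simp_all add: inner_diff_left)
  then have "(\<beta> * shape 1 1 u0 - \<alpha> * shape 2 1 u0) *\<^sub>R pd 1 X u0
      + (\<beta> * shape 1 2 u0 - \<alpha> * shape 2 2 u0) *\<^sub>R pd 2 X u0 = 0"
    unfolding pd_N_eq[OF u0, of 1] pd_N_eq[OF u0, of 2] by (simp add: algebra_simps)
  \<comment> \<open>The coefficient vector \<open>(\<beta>, - \<alpha>)\<close> is annihilated by
    the shape matrix, whose determinant is \<open>k1 * k2\<close>. Then \<open>E\<close> is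
    orthogonal to \<open>Z q\<close>, of which it is a positive multiple.\<close>
  from X_independent[OF u0 this] det[OF u0]
  have "\<alpha> * (k1 * k2) = 0" "\<beta> * (k1 * k2) = 0" by algebra+
  then have "E u0 \<bullet> Z k u0 = 0" for k
    using assms(3) exhaust_2[of k] by (auto simp: \<alpha>_def \<beta>_def)
  then have "E u0 \<bullet> Z q u0 = 0" .
  then have "E u0 \<bullet> E u0 = 0" by (auto simp: E_def)
  with E1[OF u0V] show False by simp
qed

text \<open>Trace and determinant of the shape matrix are constant, hence so is the discriminant
  \<open>c\<^sup>2 - 4 * K\<close>. It is nonnegative by self-adjointness and cannot be positive,
  and when it is zero the matrix is scalar.\<close>

lemma type_1_umbilic:
  assumes det: "\<And>u. u \<in> U \<Longrightarrow> det (second_form X N u) \<noteq> 0"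
    and T: "\<And>u. u \<in> U \<Longrightarrow> vec_beltrami2 (second_form X N) N u = c *\<^sub>R N u"
    and u: "u \<in> U"
  shows "pd i N u = (- c / 2) *\<^sub>R pd i X u"
proof -
  let ?K = "\<lambda>u. shape 1 1 u * shape 2 2 u - shape 1 2 u * shape 2 1 u"
  have tr: "shape 1 1 v + shape 2 2 v = - c" if "v \<in> U" for v
    using type_1_shape(1)[OF that det[OF that] T[OF that]] .
  have "?K constant_on U"
    using shape_differentiable type_1_shape(2)[OF _ det T]
    by (intro pd_zero_imp_constant_on open_U connected_U differentiable_diff differentiable_mult) blast+
  then obtain K where K: "\<And>v. v \<in> U \<Longrightarrow> ?K v = K" unfolding constant_on_def by blast
  have disc: "(shape 1 1 v - shape 2 2 v)\<^sup>2 + 4 * shape 1 2 v * shape 2 1 v = c\<^sup>2 - 4 * K"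
    if "v \<in> U" for v
    using tr[OF that] K[OF that] by algebra
  note dichotomy = self_adjoint_discriminant[OF shape_self_adjoint[OF u] det_g_pos[OF u]]
  have K0: "K \<noteq> 0"
  proof
    assume "K = 0"
    then have "b 1 1 u * b 2 2 u - b 1 2 u * b 2 1 u = 0"
      using K[OF u] inner_commute[of "pd 2 X u" "pd 1 X u"] unfolding second_form_shape[OF u] by algebra
    with det[OF u] show False by (simp add: det_2)
  qed
  have "c\<^sup>2 - 4 * K = 0"
  proof (rule ccontr)
    assume "c\<^sup>2 - 4 * K \<noteq> 0"
    then have pos: "c\<^sup>2 - 4 * K > 0" using dichotomy(1) disc[OF u] by simp
    define r where "r = sqrt (c\<^sup>2 - 4 * K)"
    have r: "r \<noteq> 0" "r\<^sup>2 = c\<^sup>2 - 4 * K" using pos by (auto simp: r_def)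
    \<comment> \<open>The principal curvatures are the roots of
      \<open>t\<^sup>2 - c * t + K\<close>.\<close>
    have kk: "((c + r) / 2) * ((c - r) / 2) = K"
      using r(2) by (simp add: power2_eq_square field_simps)
    show False
      by (rule not_distinct_constant_principal_curvatures[OF u, of "(c + r) / 2" "(c - r) / 2"])
        (use r(1) kk K0 tr K in \<open>auto simp: field_simps\<close>)
  qed
  then have "shape 1 1 u = shape 2 2 u \<and> shape 1 2 u = 0 \<and> shape 2 1 u = 0"
    using dichotomy(2) disc[OF u] by simp
  moreover from this have "shape 1 1 u = - c / 2" using tr[OF u] by simp
  ultimately show ?thesis using pd_N_eq[OF u, of i] exhaust_2[of i] by auto
qed

end

section \<open>From patches to the surface\<close>

lemma local_param_patch:
  assumes "local_param M x U \<phi>" "gauss_map M x n" "open B" "connected B" "B \<subseteq> U"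
  shows "surface_patch B (x \<circ> \<phi>) (n \<circ> \<phi>)"
proof
  have \<phi>: "continuous_on U \<phi>" "\<phi> ` U \<subseteq> M"
    using assms(1) unfolding local_param_def homeomorphism_def openin_subtopology by auto
  show "continuous_on B (n \<circ> \<phi>)"
    using assms(2,5) \<phi> unfolding gauss_map_def
    by (intro continuous_on_compose) (auto intro: continuous_on_subset)
  show "Ck_on 3 (x \<circ> \<phi>) B"
    using assms(1,5) Ck_on_subset unfolding local_param_def by blast
  show "norm ((n \<circ> \<phi>) u) = 1" if "u \<in> B" for u
    using assms(2,5) \<phi>(2) that unfolding gauss_map_def by (force simp: image_subset_iff)
  show "pd i (x \<circ> \<phi>) u \<bullet> (n \<circ> \<phi>) u = 0" if "u \<in> B" for u i
    using assms(1,2,5) that unfolding gauss_map_def by auto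
qed (use assms in \<open>auto simp: local_param_def\<close>)

text \<open>A coordinate domain may be disconnected; balls inside it provide connected
  patches.\<close>

lemma local_param_patch_at:
  assumes "local_param M x U \<phi>" "gauss_map M x n" "u \<in> U"
  obtains B where "u \<in> B" "B \<subseteq> U" "surface_patch B (x \<circ> \<phi>) (n \<circ> \<phi>)"
proof -
  obtain r where "r > 0" "ball u r \<subseteq> U"
    using assms(1,3) open_contains_ball unfolding local_param_def by blast
  then show ?thesis
    using that[of "ball u r"] local_param_patch[OF assms(1,2), of "ball u r"] by auto
qed

lemma elliptic_det_second_form:
  assumes "elliptic M x n" "local_param M x U \<phi>" "u \<in> U"
  shows "det (second_form (x \<circ> \<phi>) (n \<circ> \<phi>) u) \<noteq> 0"
  using assms unfolding elliptic_def gauss_curvature_def by fastforce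

text \<open>Coordinate maps are homeomorphisms onto relatively open sets, so patches have relatively
  open images and \<open>f\<close> is locally constant on the connected set
  \<open>M\<close>.\<close>

lemma constant_on_surfaceI:
  assumes "surface M x" "connected M" "gauss_map M x n"
    and const: "\<And>U \<phi> B. local_param M x U \<phi> \<Longrightarrow> B \<subseteq> U \<Longrightarrow>
      surface_patch B (x \<circ> \<phi>) (n \<circ> \<phi>) \<Longrightarrow> (f \<circ> \<phi>) constant_on B"
  shows "f constant_on M"
proof (rule locally_constant_imp_constant[OF assms(2)])
  fix p assume "p \<in> M"
  then obtain U \<phi> u where L: "local_param M x U \<phi>" and u: "u \<in> U" "p = \<phi> u"
    using assms(1) unfolding surface_def by blast
  obtain B where B: "u \<in> B" "B \<subseteq> U" "surface_patch B (x \<circ> \<phi>) (n \<circ> \<phi>)"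
    using local_param_patch_at[OF L assms(3) u(1)] .
  obtain \<psi> where "homeomorphism U (\<phi> ` U) \<phi> \<psi>" using L unfolding local_param_def by blast
  moreover have "openin (top_of_set U) B"
    using B surface_patch.open_U[OF B(3)] by (simp add: open_subset)
  ultimately have "openin (top_of_set (\<phi> ` U)) (\<phi> ` B)" by (rule homeomorphism_imp_open_map)
  then have "openin (top_of_set M) (\<phi> ` B)"
    using L openin_trans unfolding local_param_def by blast
  moreover have "f q = f p" if "q \<in> \<phi> ` B" for q
    using const[OF L B(2,3)] B(1) u(2) that unfolding constant_on_def by auto
  ultimately show "\<exists>T. openin (top_of_set M) T \<and> p \<in> T \<and> (\<forall>q\<in>T. f q = f p)"
    using B(1) u(2) by blast
qed

lemma type_1_imp_part_of_sphere:
  assumes "surface M x" "connected M" "gauss_map M x n" "elliptic M x n"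
    and "gauss_map_II_type_1 M x n"
  shows "part_of_sphere M x"
proof -
  obtain c where c: "c \<noteq> 0" and T: "\<And>U \<phi> u. local_param M x U \<phi> \<Longrightarrow> u \<in> U \<Longrightarrow>
      vec_beltrami2 (second_form (x \<circ> \<phi>) (n \<circ> \<phi>)) (n \<circ> \<phi>) u = c *\<^sub>R n (\<phi> u)"
    using assms(5) unfolding gauss_map_II_type_1_def by blast
  \<comment> \<open>Since \<open>pd i n = (- c / 2) *\<^sub>R pd i x\<close> in coordinates, the
    factor \<open>2 / c\<close> makes the derivatives cancel; the constant value is the centre of
    the sphere.\<close>
  have "(\<lambda>p. x p + (2 / c) *\<^sub>R n p) constant_on M"
  proof (rule constant_on_surfaceI[OF assms(1-3)])
    fix U \<phi> B
    assume L: "local_param M x U \<phi>" "B \<subseteq> U" and S: "surface_patch B (x \<circ> \<phi>) (n \<circ> \<phi>)"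
    interpret surface_patch B "x \<circ> \<phi>" "n \<circ> \<phi>" by (fact S)
    have "pd i (n \<circ> \<phi>) u = (- c / 2) *\<^sub>R pd i (x \<circ> \<phi>) u" if "u \<in> B" for i u
      using that L elliptic_det_second_form[OF assms(4) L(1)] T[OF L(1)]
      by (intro type_1_umbilic) auto
    then have "pd i (\<lambda>u. (x \<circ> \<phi>) u + (2 / c) *\<^sub>R (n \<circ> \<phi>) u) u = 0" if "u \<in> B" for i u
      using that differentiable[OF that] c
      by (simp add: pd_add pd_bounded_linear[OF bounded_linear_scaleR_right] del: o_apply)
    then have "(\<lambda>u. (x \<circ> \<phi>) u + (2 / c) *\<^sub>R (n \<circ> \<phi>) u) constant_on B"
      using differentiable
      by (intro pd_zero_imp_constant_on open_U connected_U differentiable_add differentiable_scaleR)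
        (auto simp del: o_apply)
    then show "((\<lambda>p. x p + (2 / c) *\<^sub>R n p) \<circ> \<phi>) constant_on B" by (simp add: o_def)
  qed
  then obtain a where a: "\<And>p. p \<in> M \<Longrightarrow> x p + (2 / c) *\<^sub>R n p = a"
    unfolding constant_on_def by blast
  \<comment> \<open>The sign of \<open>c\<close> depends on the orientation of \<open>n\<close>,
    hence the absolute value.\<close>
  have "x ` M \<subseteq> sphere a \<bar>2 / c\<bar>"
  proof (intro image_subsetI)
    fix p assume "p \<in> M"
    then have "a - x p = (2 / c) *\<^sub>R n p" "norm (n p) = 1"
      using a[of p] assms(3) by (auto simp: gauss_map_def algebra_simps)
    then show "x p \<in> sphere a \<bar>2 / c\<bar>" by (simp add: dist_norm)
  qed
  then show ?thesis using c unfolding part_of_sphere_def by (intro exI[of _ a] exI[of _ "\<bar>2 / c\<bar>"]) auto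
qed

text \<open>Constant length makes \<open>X - a\<close> orthogonal to the tangent vectors, so it is a
  multiple of \<open>N\<close>. The factor is constant because \<open>pd i N\<close> is orthogonal
  to \<open>N\<close> and \<open>N\<close> to \<open>pd i X\<close>.\<close>

lemma (in surface_patch) sphere_patch:
  assumes "\<And>u. u \<in> U \<Longrightarrow> dist a (X u) = r"
  shows "(\<lambda>u. N u \<bullet> (X u - a)) constant_on U"
    and "u \<in> U \<Longrightarrow> X u - a = (N u \<bullet> (X u - a)) *\<^sub>R N u"
proof -
  have d: "(\<lambda>u. X u - a) differentiable (at u)" if "u \<in> U" for u
    using differentiable(1)[OF that] by (intro differentiable_diff) auto
  have pdX: "pd i (\<lambda>u. X u - a) u = pd i X u" if "u \<in> U" for i u
    using pd_add[of X u "\<lambda>_. - a" i] differentiable(1)[OF that] by simp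
  have sq: "(X v - a) \<bullet> (X v - a) = r\<^sup>2" if "v \<in> U" for v
    using assms[OF that] by (simp add: power2_norm_eq_inner[symmetric] dist_norm norm_minus_commute)
  have orth: "(X u - a) \<bullet> pd i X u = 0" if "u \<in> U" for i u
    using pd_inner_const[OF that d[OF that] d[OF that] sq, of i] inner_commute[of "pd i X u" "X u - a"]
    unfolding pdX[OF that, of i] by linarith
  show eq: "X u - a = (N u \<bullet> (X u - a)) *\<^sub>R N u" if u: "u \<in> U" for u
  proof -
    have "X u - a - (N u \<bullet> (X u - a)) *\<^sub>R N u = 0"
    proof (rule frame_eq_0I[OF u])
      show "(X u - a - (N u \<bullet> (X u - a)) *\<^sub>R N u) \<bullet> pd i X u = 0" for i
        unfolding inner_diff_left[of "X u - a"] orth[OF u] using tangent_N'[OF u] by simp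
      have "N u \<bullet> N u = 1" using norm_N[OF u] by (simp add: norm_eq_1)
      then show "(X u - a - (N u \<bullet> (X u - a)) *\<^sub>R N u) \<bullet> N u = 0"
        unfolding inner_diff_left[of "X u - a"] inner_commute[of "X u - a" "N u"] by simp
    qed
    then show ?thesis by simp
  qed
  show "(\<lambda>u. N u \<bullet> (X u - a)) constant_on U"
  proof (intro pd_zero_imp_constant_on open_U connected_U)
    fix u i assume u: "u \<in> U"
    show "(\<lambda>u. N u \<bullet> (X u - a)) differentiable (at u)"
      using differentiable(4)[OF u] d[OF u] by (rule differentiable_inner)
    have "pd i N u \<bullet> (X u - a) = 0"
      by (subst eq[OF u]) (simp add: pd_N_inner_N[OF u])
    then show "pd i (\<lambda>u. N u \<bullet> (X u - a)) u = 0"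
      using pd_inner[OF differentiable(4)[OF u] d[OF u], of i] pdX[OF u] tangent_N'[OF u] by simp
  qed
qed

lemma part_of_sphere_imp_type_1:
  assumes "surface M x" "connected M" "gauss_map M x n" "elliptic M x n"
    and "part_of_sphere M x"
  shows "gauss_map_II_type_1 M x n"
proof -
  obtain a r where r: "r > 0" and S: "x ` M \<subseteq> sphere a r"
    using assms(5) unfolding part_of_sphere_def by blast
  have sub: "\<phi> ` U \<subseteq> M" if "local_param M x U \<phi>" for U \<phi>
    using that unfolding local_param_def openin_subtopology by auto
  have sphere: "dist a ((x \<circ> \<phi>) u) = r" if "local_param M x U \<phi>" "u \<in> U" for U \<phi> u
  proof -
    have "x (\<phi> u) \<in> sphere a r" using sub[OF that(1)] that(2) S by blast
    then show ?thesis by simp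
  qed
  have normal: "x p - a = (n p \<bullet> (x p - a)) *\<^sub>R n p" if "p \<in> M" for p
  proof -
    obtain U \<phi> u where L: "local_param M x U \<phi>" and u: "u \<in> U" "p = \<phi> u"
      using assms(1) \<open>p \<in> M\<close> unfolding surface_def by blast
    obtain B where B: "u \<in> B" "B \<subseteq> U" "surface_patch B (x \<circ> \<phi>) (n \<circ> \<phi>)"
      using local_param_patch_at[OF L assms(3) u(1)] .
    show ?thesis
      using surface_patch.sphere_patch(2)[OF B(3), of a r u] sphere[OF L] B u(2) by auto
  qed
  \<comment> \<open>Connectedness of \<open>M\<close> fixes one sign of the normal relative to the
    radius, hence one eigenvalue for all coordinate maps.\<close>
  have "(\<lambda>p. n p \<bullet> (x p - a)) constant_on M"
  proof (rule constant_on_surfaceI[OF assms(1-3)])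
    fix U \<phi> B
    assume L: "local_param M x U \<phi>" "B \<subseteq> U" and "surface_patch B (x \<circ> \<phi>) (n \<circ> \<phi>)"
    from surface_patch.sphere_patch(1)[OF this(3), of a r] sphere[OF L(1)] L(2)
    show "((\<lambda>p. n p \<bullet> (x p - a)) \<circ> \<phi>) constant_on B" by (auto simp: o_def)
  qed
  then obtain s where s: "\<And>p. p \<in> M \<Longrightarrow> n p \<bullet> (x p - a) = s"
    unfolding constant_on_def by blast
  have N: "s \<noteq> 0 \<and> n p = (1 / s) *\<^sub>R (x p - a)" if "p \<in> M" for p
  proof -
    have "x p - a = s *\<^sub>R n p" using normal[OF that] s[OF that] by simp
    moreover from this have "s \<noteq> 0" using S r that by (auto simp: dist_norm)
    ultimately show ?thesis by simp
  qed
  \<comment> \<open>The derivatives of \<open>n\<close> are \<open>1 / s\<close> times those of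
    \<open>x\<close>, so \<open>beltrami2_N_homothetic\<close> yields \<open>- 2 / s\<close>. For
    empty \<open>M\<close>, where \<open>s\<close> could be zero, any nonzero value will do.\<close>
  define c where "c = (if M = {} then 1 else - 2 / s)"
  have "c \<noteq> 0" using N by (auto simp: c_def)
  moreover have "vec_beltrami2 (second_form (x \<circ> \<phi>) (n \<circ> \<phi>)) (n \<circ> \<phi>) u = c *\<^sub>R n (\<phi> u)"
    if L: "local_param M x U \<phi>" and u: "u \<in> U" for U \<phi> u
  proof -
    obtain B where B: "u \<in> B" "B \<subseteq> U" "surface_patch B (x \<circ> \<phi>) (n \<circ> \<phi>)"
      using local_param_patch_at[OF L assms(3) u] .
    interpret surface_patch B "x \<circ> \<phi>" "n \<circ> \<phi>" by (fact B(3))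
    have "pd i (n \<circ> \<phi>) v = (1 / s) *\<^sub>R pd i (x \<circ> \<phi>) v" if v: "v \<in> B" for v i
    proof -
      have "pd i (n \<circ> \<phi>) v = pd i (\<lambda>v. (1 / s) *\<^sub>R (x \<circ> \<phi>) v + (- 1 / s) *\<^sub>R a) v"
        using N sub[OF L] B(2) by (intro pd_cong[OF open_U v]) (auto simp: algebra_simps)
      also have "\<dots> = pd i (\<lambda>v. (1 / s) *\<^sub>R (x \<circ> \<phi>) v) v + pd i (\<lambda>v. (- 1 / s) *\<^sub>R a) v"
        using differentiable(1)[OF v] by (intro pd_add differentiable_scaleR) (auto simp del: o_apply)
      also have "\<dots> = (1 / s) *\<^sub>R pd i (x \<circ> \<phi>) v"
        using pd_bounded_linear[OF bounded_linear_scaleR_right differentiable(1)[OF v]] by simp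
      finally show ?thesis .
    qed
    moreover have "M \<noteq> {}" using sub[OF L] u by auto
    ultimately show ?thesis
      using beltrami2_N_homothetic[OF B(1) elliptic_det_second_form[OF assms(4) L u], of "1 / s"]
      by (simp add: c_def)
  qed
  ultimately show ?thesis unfolding gauss_map_II_type_1_def by blast
qed

theorem theorem2p2:
  fixes M :: "'m::t2_space set" and x n :: "'m \<Rightarrow> real^3"
  assumes "surface M x" and "connected M"
    and "gauss_map M x n"
    and "elliptic M x n"
  shows "gauss_map_II_type_1 M x n \<longleftrightarrow> part_of_sphere M x"
  using type_1_imp_part_of_sphere[OF assms] part_of_sphere_imp_type_1[OF assms] by blast

end
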